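(* Let $\mathcal G$ be a $d$-rigid graph and let $(\nu,\eta)$ be a compatible formation controller on $\mathcal G$ defined by rational functions. If the controller is locally exponentially stable at some generic target configuration $p^*$ (with $m^*=F(p^* )$), then the controller is strongly admissible.
   Context: Fix $d\ge 1$ and a finite simple graph $\mathcal G=(\mathcal V,\mathcal E)$, $\mathcal V=\{1,\dots,n\}$. A configuration is $p=(p_1,\dots,p_n)\in(\mathbb R^d)^n=\mathbb R^{dn}$. The distance map is $F:\mathbb R^{dn}\to\mathbb R^{|\mathcal E|}$, $F(p)=(\|p_j-p_i\|^2)_{ij\in\mathcal E}$. The rigidity matrix $R(p)$ has, in the row of edge $ij$, the block $(p_i-p_j)^\top$ at vertex $i$, $(p_j-p_i)^\top$ at vertex $j$, and zeros elsewhere; so $\mathrm dF_p=2R(p)$. Configurations are congruent if they differ by a Euclidean isometry of $\mathbb R^d$. Regular values: $m\in F(\mathbb R^{dn})$ is a regular value if near $m$ the image $F(\mathbb R^{dn})$ is a smooth embedded submanifold of $\mathbb R^{|\mathcal E|}$ and $\mathrm dF_p$ maps onto its tangent space at $m$ for every $p\in F^{-1}(m)$. $\mathcal Q$ is the set of regular values, $\mathcal C=F^{-1}(\mathcal Q)$; for $m=F(p)\in\mathcal Q$, $T_m\mathcal Q=\operatorname{im}R(p)$. The graph $\mathcal G$ is $d$-rigid if for every $p\in\mathcal C$ there is a neighborhood of $p$ in which every $q$ with $F(q)=F(p)$ is congruent to $p$. $\mathcal S=\{(p,m)\in\mathcal C\times\mathcal Q: F(p)=m\}$. A compatible formation controller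 is a pair of linear operators $\nu_{(p,m)}:\mathbb R^{|\mathcal E|}\to\mathbb R^{dn}$, $\eta_{(p,m)}:\mathbb R^{|\mathcal E|}\to\mathbb R^{|\mathcal E|}$, depending smoothly on $(p,m)\in\mathcal S$, with $(\nu_{(p,m)}x,\eta_{(p,m)}x)\in T_{(p,m)}\mathcal S$ for all $x$, equivalently $\eta_{(p,m)}=2R(p)\nu_{(p,m)}$. It is defined by rational functions if the matrix entries of $\nu,\eta$ are rational functions, with coefficients in $\mathbb Q$, of the coordinates of $(p,m)$. The closed-loop system with target $(p^*,m^* )$ is $\dot p=\nu_{(p,m)}(m^*-m)$, $\dot m=\eta_{(p,m)}(m^*-m)$. The controller is locally exponentially stable at $p^*\in\mathcal C$ if there is a neighborhood $U\ni p^*$ such that, for all initial conditions $(p^0,F(p^0))$ with $p^0\in U$, the node trajectory $p(t)$ converges exponentially to a configuration $q\in U$ congruent to $p^*$; exponential convergence means $\|p(t)-q\|\le Ke^{-ct}$ for all $t\ge0$, with constants $K,c>0$ not depending on $p^0\in U$. Genericity: a generic configuration is an element of $\mathcal C$ lying outside an (unspecified) proper algebraic subset $X\subsetneq\mathbb R^{dn}$ defined over $\mathbb Q$ and depending only on $d$, $\mathcal G$ and the controller. "For every generic $p$" means: for some such $X$, for all $p\in\mathcal C\setminus X$. A result with a hypothesis at "some generic target" asserts that there is such an $X$ for which the result holds whenever the hypothesis is satisfied at some $p^*\in\mathcal C\setminus X$. The controller is strongly admissible if, for every generic $p\in\mathcal C$, the map $\eta_{(p,F(p))}|_{T_{F(p)}\mathcal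 Q}$ is hyperbolic, i.e. all its eigenvalues have non-zero real part. *)

theory Defs
  imports "HOL-Analysis.Analysis"
begin

section \<open>Smooth maps, embedded submanifolds and tangent spaces\<close>

text \<open>\<open>Ck_on k S f\<close> is only meant for open \<open>S\<close>: \<open>f\<close> is of class $C^k$ on \<open>S\<close>, by recursion on the
  directional derivatives.\<close>

primrec Ck_on :: "nat \<Rightarrow> 'a::euclidean_space set \<Rightarrow> ('a \<Rightarrow> 'b::euclidean_space) \<Rightarrow> bool" where
  "Ck_on 0 S f \<longleftrightarrow> continuous_on S f"
| "Ck_on (Suc k) S f \<longleftrightarrow>
     (\<forall>x\<in>S. f differentiable (at x)) \<and> (\<forall>v. Ck_on k S (\<lambda>x. frechet_derivative f (at x) v))"

definition smooth_on :: "'a::euclidean_space set \<Rightarrow> ('a \<Rightarrow> 'b::euclidean_space) \<Rightarrow> bool" where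
  "smooth_on S f \<longleftrightarrow> open S \<and> (\<forall>k. Ck_on k S f)"

text \<open>Smoothness on a subset that need not be open (here: an embedded submanifold), by local smooth
  extensions to the ambient space.\<close>

definition smooth_on_subset :: "'a::euclidean_space set \<Rightarrow> ('a \<Rightarrow> 'b::euclidean_space) \<Rightarrow> bool" where
  "smooth_on_subset S f \<longleftrightarrow>
     (\<forall>s\<in>S. \<exists>U g. s \<in> U \<and> smooth_on U g \<and> (\<forall>x\<in>S \<inter> U. g x = f x))"

definition embedded_submanifold :: "'a::euclidean_space set \<Rightarrow> bool" where
  "embedded_submanifold M \<longleftrightarrow>
     (\<exists>k. \<forall>x\<in>M. \<exists>U V \<phi> \<psi> L.
        x \<in> U \<and> smooth_on U (\<phi> :: 'a \<Rightarrow> 'a) \<and> smooth_on V (\<psi> :: 'a \<Rightarrow> 'a) \<and>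
        \<phi> ` U = V \<and> \<psi> ` V = U \<and> (\<forall>u\<in>U. \<psi> (\<phi> u) = u) \<and> (\<forall>v\<in>V. \<phi> (\<psi> v) = v) \<and>
        subspace L \<and> dim L = k \<and> \<phi> ` (U \<inter> M) = V \<inter> L)"

text \<open>Velocity vectors at \<open>x\<close> of smooth curves in \<open>M\<close>; for an embedded submanifold this is the tangent
  space.\<close>

definition tangent_space :: "'a::euclidean_space set \<Rightarrow> 'a \<Rightarrow> 'a set" where
  "tangent_space M x =
     {v. \<exists>\<gamma> \<epsilon>. (\<epsilon>::real) > 0 \<and> smooth_on {-\<epsilon><..<\<epsilon>} \<gamma> \<and> \<gamma> ` {-\<epsilon><..<\<epsilon>} \<subseteq> M \<and>
              \<gamma> 0 = x \<and> (\<gamma> has_vector_derivative v) (at 0)}"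


section \<open>Polynomials, rational functions and algebraic sets over the rationals\<close>

text \<open>Analogue of \<^const>\<open>real_polynomial_function\<close> with rational coefficients; the variables are the
  coordinates with respect to \<^const>\<open>Basis\<close>.\<close>

inductive rat_polynomial_function :: "('a::euclidean_space \<Rightarrow> real) \<Rightarrow> bool" where
  coord: "b \<in> Basis \<Longrightarrow> rat_polynomial_function (\<lambda>x. x \<bullet> b)"
| const: "c \<in> \<rat> \<Longrightarrow> rat_polynomial_function (\<lambda>x. c)"
| add: "\<lbrakk>rat_polynomial_function f; rat_polynomial_function g\<rbrakk>
        \<Longrightarrow> rat_polynomial_function (\<lambda>x. f x + g x)"
| mult: "\<lbrakk>rat_polynomial_function f; rat_polynomial_function g\<rbrakk>
        \<Longrightarrow> rat_polynomial_function (\<lambda>x. f x * g x)"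

text \<open>The denominator may have zeros in \<open>S\<close> (removable singularities), but not vanish on all of
  \<open>S\<close>.\<close>

definition rational_function_on :: "'a::euclidean_space set \<Rightarrow> ('a \<Rightarrow> real) \<Rightarrow> bool" where
  "rational_function_on S f \<longleftrightarrow>
     (\<exists>P D. rat_polynomial_function P \<and> rat_polynomial_function D \<and>
            (\<exists>s\<in>S. D s \<noteq> 0) \<and> (\<forall>s\<in>S. D s \<noteq> 0 \<longrightarrow> f s = P s / D s))"

definition proper_algebraic_over_rat :: "'a::euclidean_space set \<Rightarrow> bool" where
  "proper_algebraic_over_rat X \<longleftrightarrow>
     X \<noteq> UNIV \<and>
     (\<exists>A. finite A \<and> (\<forall>P\<in>A. rat_polynomial_function P) \<and> X = {x. \<forall>P\<in>A. P x = 0})"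


section \<open>Linear maps on subspaces and hyperbolicity\<close>

definition linear_map_on :: "'a::real_vector set \<Rightarrow> ('a \<Rightarrow> 'b::real_vector) \<Rightarrow> bool" where
  "linear_map_on V f \<longleftrightarrow>
     (\<forall>x\<in>V. \<forall>y\<in>V. \<forall>a b. f (a *\<^sub>R x + b *\<^sub>R y) = a *\<^sub>R f x + b *\<^sub>R f y)"

definition Re_vec :: "complex^'n \<Rightarrow> real^'n" where
  "Re_vec z = (\<chi> i. Re (z $ i))"

definition Im_vec :: "complex^'n \<Rightarrow> real^'n" where
  "Im_vec z = (\<chi> i. Im (z $ i))"

definition complexify :: "(real^'n \<Rightarrow> real^'n) \<Rightarrow> complex^'n \<Rightarrow> complex^'n" where
  "complexify A z = (\<chi> i. Complex (A (Re_vec z) $ i) (A (Im_vec z) $ i))"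

text \<open>Complex eigenvalues of the restriction of \<open>A\<close> to a real invariant subspace \<open>W\<close>: the eigenvector
  lies in the complexification of \<open>W\<close>.\<close>

definition eigenvalue_on :: "(real^'n) set \<Rightarrow> (real^'n \<Rightarrow> real^'n) \<Rightarrow> complex \<Rightarrow> bool" where
  "eigenvalue_on W A \<mu> \<longleftrightarrow>
     (\<exists>z. z \<noteq> 0 \<and> Re_vec z \<in> W \<and> Im_vec z \<in> W \<and> complexify A z = \<mu> *s z)"

definition hyperbolic_on :: "(real^'n) set \<Rightarrow> (real^'n \<Rightarrow> real^'n) \<Rightarrow> bool" where
  "hyperbolic_on W A \<longleftrightarrow> (\<forall>\<mu>. eigenvalue_on W A \<mu> \<longrightarrow> Re \<mu> \<noteq> 0)"


section \<open>Frameworks and formation controllers\<close>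

text \<open>The vertex set is the type \<open>'v\<close> and a graph is given by its edge set \<open>E\<close>. The space of functions
  on the edges is the coordinate subspace \<open>edge_space E\<close> of the functions on all sets of vertices; in
  this way an edgeless graph is not excluded.\<close>

definition simple_graph :: "'v::finite set set \<Rightarrow> bool" where
  "simple_graph E \<longleftrightarrow> (\<forall>e\<in>E. card e = 2)"

definition edge_space :: "'v::finite set set \<Rightarrow> (real^('v set)) set" where
  "edge_space E = {x. \<forall>e. e \<notin> E \<longrightarrow> x $ e = 0}"

definition distance_map :: "'v::finite set set \<Rightarrow> real^'d^'v \<Rightarrow> real^('v set)" where
  "distance_map E p =
     (\<chi> e. if e \<in> E then (THE r. \<exists>i j. e = {i, j} \<and> r = (norm (p $ j - p $ i))\<^sup>2) else 0)"

lemma distance_map_edge: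
  assumes "{i, j} \<in> E"
  shows "distance_map E p $ {i, j} = (norm (p $ j - p $ i))\<^sup>2"
proof -
  have "(THE r. \<exists>i' j'. {i, j} = {i', j'} \<and> r = (norm (p $ j' - p $ i'))\<^sup>2)
        = (norm (p $ j - p $ i))\<^sup>2"
    by (rule the_equality) (auto simp: doubleton_eq_iff norm_minus_commute)
  with assms show ?thesis
    by (simp add: distance_map_def)
qed

definition congruent_config :: "real^'d^'v \<Rightarrow> real^'d^'v \<Rightarrow> bool" where
  "congruent_config p q \<longleftrightarrow>
     (\<exists>T :: real^'d \<Rightarrow> real^'d. (\<forall>x y. dist (T x) (T y) = dist x y) \<and> (\<forall>i. q $ i = T (p $ i)))"

definition regular_value :: "'d::finite itself \<Rightarrow> 'v::finite set set \<Rightarrow> real^('v set) \<Rightarrow> bool" where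
  "regular_value d E m \<longleftrightarrow>
     (let F = (distance_map E :: real^'d^'v \<Rightarrow> _) in
        m \<in> range F \<and>
        (\<exists>W. open W \<and> m \<in> W \<and> embedded_submanifold (range F \<inter> W)) \<and>
        (\<forall>p. F p = m \<longrightarrow> range (frechet_derivative F (at p)) = tangent_space (range F) m))"

definition regular_values :: "'d::finite itself \<Rightarrow> 'v::finite set set \<Rightarrow> (real^('v set)) set" where
  "regular_values d E = {m. regular_value d E m}"

definition regular_configs :: "'v::finite set set \<Rightarrow> (real^'d::finite^'v) set" where
  "regular_configs E = {p. distance_map E p \<in> regular_values TYPE('d) E}"

definition rigid_graph :: "'d::finite itself \<Rightarrow> 'v::finite set set \<Rightarrow> bool" where
  "rigid_graph d E \<longleftrightarrow>
     (\<forall>p\<in>(regular_configs E :: (real^'d^'v) set). \<exists>U. open U \<and> p \<in> U \<and>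
        (\<forall>q\<in>U. distance_map E q = distance_map E p \<longrightarrow> congruent_config q p))"

definition state_space :: "'v::finite set set \<Rightarrow> ((real^'d::finite^'v) \<times> (real^('v set))) set" where
  "state_space E =
     {(p, m). p \<in> regular_configs E \<and> m \<in> regular_values TYPE('d) E \<and> distance_map E p = m}"

text \<open>The values of the operators outside \<open>edge_space E\<close> are irrelevant here and below.\<close>

definition compatible_controller ::
  "'v::finite set set
   \<Rightarrow> ((real^'d::finite^'v) \<times> (real^('v set)) \<Rightarrow> real^('v set) \<Rightarrow> real^'d^'v)
   \<Rightarrow> ((real^'d^'v) \<times> (real^('v set)) \<Rightarrow> real^('v set) \<Rightarrow> real^('v set)) \<Rightarrow> bool" where
  "compatible_controller E \<nu> \<eta> \<longleftrightarrow>
     (\<forall>s\<in>state_space E.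
        linear_map_on (edge_space E) (\<nu> s) \<and> linear_map_on (edge_space E) (\<eta> s) \<and>
        \<eta> s ` edge_space E \<subseteq> edge_space E \<and>
        (\<forall>x\<in>edge_space E. (\<nu> s x, \<eta> s x) \<in> tangent_space (state_space E) s)) \<and>
     (\<forall>x\<in>edge_space E.
        smooth_on_subset (state_space E) (\<lambda>s. \<nu> s x) \<and>
        smooth_on_subset (state_space E) (\<lambda>s. \<eta> s x))"

definition rational_controller ::
  "'v::finite set set
   \<Rightarrow> ((real^'d::finite^'v) \<times> (real^('v set)) \<Rightarrow> real^('v set) \<Rightarrow> real^'d^'v)
   \<Rightarrow> ((real^'d^'v) \<times> (real^('v set)) \<Rightarrow> real^('v set) \<Rightarrow> real^('v set)) \<Rightarrow> bool" where
  "rational_controller E \<nu> \<eta> \<longleftrightarrow>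
     (\<forall>e\<in>E. \<forall>i k. rational_function_on (state_space E) (\<lambda>s. \<nu> s (axis e 1) $ i $ k)) \<and>
     (\<forall>e\<in>E. \<forall>e'\<in>E. rational_function_on (state_space E) (\<lambda>s. \<eta> s (axis e 1) $ e'))"

definition closed_loop_solution ::
  "'v::finite set set
   \<Rightarrow> ((real^'d::finite^'v) \<times> (real^('v set)) \<Rightarrow> real^('v set) \<Rightarrow> real^'d^'v)
   \<Rightarrow> ((real^'d^'v) \<times> (real^('v set)) \<Rightarrow> real^('v set) \<Rightarrow> real^('v set))
   \<Rightarrow> real^('v set) \<Rightarrow> (real \<Rightarrow> real^'d^'v) \<Rightarrow> (real \<Rightarrow> real^('v set)) \<Rightarrow> bool" where
  "closed_loop_solution E \<nu> \<eta> mstar p m \<longleftrightarrow>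
     (\<forall>t\<ge>0. (p t, m t) \<in> state_space E \<and>
        (p has_vector_derivative \<nu> (p t, m t) (mstar - m t)) (at t within {0..}) \<and>
        (m has_vector_derivative \<eta> (p t, m t) (mstar - m t)) (at t within {0..}))"

text \<open>The trajectory is unique because the closed-loop vector field is smooth on the state space, so
  the existential quantifier over \<open>p\<close> and \<open>m\<close> just names it and says that it exists for all
  positive times.\<close>

definition locally_exponentially_stable ::
  "'v::finite set set
   \<Rightarrow> ((real^'d::finite^'v) \<times> (real^('v set)) \<Rightarrow> real^('v set) \<Rightarrow> real^'d^'v)
   \<Rightarrow> ((real^'d^'v) \<times> (real^('v set)) \<Rightarrow> real^('v set) \<Rightarrow> real^('v set))
   \<Rightarrow> real^'d^'v \<Rightarrow> bool" where
  "locally_exponentially_stable E \<nu> \<eta> pstar \<longleftrightarrow>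
     (\<exists>U K c. open U \<and> pstar \<in> U \<and> U \<subseteq> regular_configs E \<and> K > 0 \<and> c > 0 \<and>
        (\<forall>p0\<in>U. \<exists>p m q.
           closed_loop_solution E \<nu> \<eta> (distance_map E pstar) p m \<and>
           p 0 = p0 \<and> m 0 = distance_map E p0 \<and>
           q \<in> U \<and> congruent_config q pstar \<and>
           (\<forall>t\<ge>0. norm (p t - q) \<le> K * exp (- c * t))))"

definition strongly_admissible ::
  "'v::finite set set
   \<Rightarrow> ((real^'d::finite^'v) \<times> (real^('v set)) \<Rightarrow> real^('v set) \<Rightarrow> real^('v set)) \<Rightarrow> bool" where
  "strongly_admissible E \<eta> \<longleftrightarrow>
     (\<exists>X. proper_algebraic_over_rat X \<and>
        (\<forall>p\<in>regular_configs E - X.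
           hyperbolic_on (tangent_space (regular_values TYPE('d) E) (distance_map E p))
                         (\<eta> (p, distance_map E p))))"

end

theory Submission
  imports Defs "HOL-Computational_Algebra.Polynomial"
begin

text \<open>
  Write \<open>F\<close> for the distance map and \<open>T\<^sub>p\<close> for the range of its derivative at \<open>p\<close>, that is, the range of
  \<open>R p\<close>. The idea is that hyperbolicity of \<open>\<eta>\<close> on \<open>T\<^sub>p\<close> follows from the nonvanishing of one rational
  function of \<open>p\<close>, and that exponential stability at a single target makes this function nonzero there.

  The function is the determinant of the Lyapunov operator \<open>S \<mapsto> \<eta> S + S \<eta>\<^sup>T\<close>, whose eigenvalues are the
  sums of two eigenvalues of \<open>\<eta>\<close>. If it is injective, then \<open>\<eta>\<close> has no imaginary eigenvalue, because the
  real and imaginary parts of an eigenvector \<open>x + \<i>y\<close> would give the kernel element \<open>x x\<^sup>T + y y\<^sup>T\<close>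
  (\<open>lyapunov_matrix_no_imaginary_pair\<close>). Conversely, if the flow of \<open>- \<eta>\<close> contracts, then it is injective,
  because the flow leaves kernel elements invariant (\<open>lyapunov_matrix_det_nonzero\<close>).

  To have one operator of fixed size instead of a family of operators on the varying spaces \<open>T\<^sub>p\<close>, a set \<open>J\<close>
  of coordinates is chosen once and for all such that the coordinate space of \<open>J\<close> is a complement of
  \<open>T\<^sub>p\<close> for every \<open>p\<close> outside a hypersurface (\<open>obtain_generic_complement\<close>). The operator \<open>\<eta>\<close> is used on
  \<open>T\<^sub>p\<close> and the identity on the complement. The map \<open>augmented_gram J\<close>, which is \<open>R R\<^sup>T\<close> plus the
  coordinate projection, is polynomial in \<open>p\<close> and respects this decomposition; composing with it
  avoids inverses and keeps all matrix entries polynomial.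

  It remains to show that stability at the target \<open>z\<close> makes the linear flow of \<open>- \<eta>\<close> contract \<open>T\<^sub>z\<close>.
  The hypothesis bounds the error \<open>x = F p - F z\<close> only by \<open>N exp (- c t)\<close> with \<open>N\<close> independent of the
  initial error, so one cannot simply linearize. Interpolating with the trivial growth bound shows that trajectories
  starting at distance \<open>\<delta>\<close> stay within a power of \<open>\<delta>\<close> of \<open>z\<close>, so that the error solves a linear equation with
  coefficients that differ from those at \<open>z\<close> by a power of \<open>\<delta>\<close>. Comparing at a time \<open>T\<close> proportional to
  \<open>- ln \<delta>\<close> at which \<open>exp (- c T)\<close> is small relative to \<open>\<delta>\<close>, every exponential rate bounding the linear
  flow can be lowered by a fixed amount; iterating, it becomes negative (\<open>linear_flow_decays\<close>).
  In this comparison \<open>x\<close> must be almost tangent to \<open>T\<^sub>z\<close>. As \<open>F\<close> is quadratic, \<open>x\<close> lies exactly in \<open>T\<^sub>q\<close>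
  for the midpoint \<open>q\<close> of \<open>p\<close> and \<open>z\<close>, and \<open>T\<^sub>q\<close> is close to \<open>T\<^sub>z\<close> as both are complements of the same
  coordinate space (\<open>range_projection_defect\<close>).
\<close>

section \<open>Polynomial functions over the rationals\<close>

lemma rat_polynomial_function_sum:
  assumes "\<And>i. i \<in> I \<Longrightarrow> rat_polynomial_function (f i)"
  shows "rat_polynomial_function (\<lambda>x. \<Sum>i\<in>I. f i x)"
  using assms
  by (induction I rule: infinite_finite_induct)
     (simp_all add: rat_polynomial_function.const rat_polynomial_function.add
        rat_polynomial_function.mult)

lemma rat_polynomial_function_prod:
  assumes "\<And>i. i \<in> I \<Longrightarrow> rat_polynomial_function (f i)"
  shows "rat_polynomial_function (\<lambda>x. \<Prod>i\<in>I. f i x)"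
  using assms
  by (induction I rule: infinite_finite_induct)
     (simp_all add: rat_polynomial_function.const rat_polynomial_function.add
        rat_polynomial_function.mult)

lemma rat_polynomial_function_diff:
  assumes "rat_polynomial_function f" "rat_polynomial_function g"
  shows "rat_polynomial_function (\<lambda>x. f x - g x)"
proof -
  have "rat_polynomial_function (\<lambda>x. f x + (- 1) * g x)"
    using assms
    by (intro rat_polynomial_function.add rat_polynomial_function.mult
          rat_polynomial_function.const) auto
  then show ?thesis by simp
qed

lemma rat_polynomial_function_det:
  fixes M :: "'a::euclidean_space \<Rightarrow> real^'n^'n"
  assumes "\<And>i j. rat_polynomial_function (\<lambda>x. M x $ i $ j)"
  shows "rat_polynomial_function (\<lambda>x. det (M x))"
  unfolding det_def
  by (intro rat_polynomial_function_sum rat_polynomial_function.mult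
        rat_polynomial_function_prod assms rat_polynomial_function.const)
     (auto simp: sign_def)

lemma rat_polynomial_function_compose:
  assumes "rat_polynomial_function f"
    and "\<And>b. b \<in> Basis \<Longrightarrow> rat_polynomial_function (\<lambda>x. g x \<bullet> b)"
  shows "rat_polynomial_function (\<lambda>x. f (g x))"
  using assms
  by induction
     (simp_all add: rat_polynomial_function.const rat_polynomial_function.add
        rat_polynomial_function.mult)

lemma rat_polynomial_function_on_line:
  assumes "rat_polynomial_function f"
  shows "\<exists>q. \<forall>t. f (a + t *\<^sub>R v) = poly q t"
  using assms
proof induction
  case (coord b)
  show ?case
    by (rule exI[of _ "[:a \<bullet> b, v \<bullet> b:]"]) (simp add: inner_add_left)
next
  case (const c)
  show ?case
    by (rule exI[of _ "[:c:]"]) simp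
next
  case (add f g)
  then obtain q r where "\<forall>t. f (a + t *\<^sub>R v) = poly q t" "\<forall>t. g (a + t *\<^sub>R v) = poly r t"
    by blast
  then show ?case by (intro exI[of _ "q + r"]) simp
next
  case (mult f g)
  then obtain q r where "\<forall>t. f (a + t *\<^sub>R v) = poly q t" "\<forall>t. g (a + t *\<^sub>R v) = poly r t"
    by blast
  then show ?case by (intro exI[of _ "q * r"]) simp
qed

text \<open>Two nonzero polynomials share a point at which neither vanishes: on the line through a
  non-root of each of them, both restrict to nonzero polynomials in one variable.\<close>

lemma rat_polynomial_function_mult_nonzero:
  assumes f: "rat_polynomial_function f" "f a \<noteq> 0"
    and g: "rat_polynomial_function g" "g b \<noteq> 0"
  shows "\<exists>x. f x * g x \<noteq> 0"
proof -
  obtain q where q: "\<And>t. f (a + t *\<^sub>R (b - a)) = poly q t"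
    using rat_polynomial_function_on_line[OF f(1)] by blast
  obtain r where r: "\<And>t. g (a + t *\<^sub>R (b - a)) = poly r t"
    using rat_polynomial_function_on_line[OF g(1)] by blast
  have "poly q 0 \<noteq> 0" "poly r 1 \<noteq> 0"
    using q[of 0] r[of 1] f(2) g(2) by simp_all
  then have "q * r \<noteq> 0" by auto
  then obtain t where "poly (q * r) t \<noteq> 0"
    using poly_all_0_iff_0 by blast
  then have "f (a + t *\<^sub>R (b - a)) * g (a + t *\<^sub>R (b - a)) \<noteq> 0"
    by (simp add: q r)
  then show ?thesis by blast
qed

lemma rat_polynomial_function_prod_nonzero:
  assumes "finite I"
    and "\<And>i. i \<in> I \<Longrightarrow> rat_polynomial_function (f i)"
    and "\<And>i. i \<in> I \<Longrightarrow> \<exists>x. f i x \<noteq> 0"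
  shows "\<exists>x. (\<Prod>i\<in>I. f i x) \<noteq> 0"
  using assms
proof (induction I)
  case empty
  then show ?case by simp
next
  case (insert i I)
  from insert.IH insert.prems obtain y where "(\<Prod>i\<in>I. f i y) \<noteq> 0" by blast
  moreover from insert.prems(2) obtain x where "f i x \<noteq> 0" by blast
  ultimately have "\<exists>z. f i z * (\<Prod>i\<in>I. f i z) \<noteq> 0"
    using insert.prems
    by (intro rat_polynomial_function_mult_nonzero rat_polynomial_function_prod) auto
  then show ?case using insert.hyps by simp
qed

lemma proper_algebraic_over_rat_zeros:
  assumes "rat_polynomial_function h" "h x \<noteq> 0"
  shows "proper_algebraic_over_rat {y. h y = 0}"
  unfolding proper_algebraic_over_rat_def
proof
  show "{y. h y = 0} \<noteq> UNIV" using assms(2) by blast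
  show "\<exists>A. finite A \<and> (\<forall>P\<in>A. rat_polynomial_function P) \<and> {y. h y = 0} = {x. \<forall>P\<in>A. P x = 0}"
    using assms(1) by (intro exI[of _ "{h}"]) auto
qed


section \<open>Linear maps with a coordinate complement\<close>

text \<open>With respect to the standard bases, \<open>gram f\<close> is \<open>f f\<^sup>T\<close>.\<close>

definition gram :: "('a::euclidean_space \<Rightarrow> real^'n) \<Rightarrow> real^'n \<Rightarrow> real^'n" where
  "gram f y = (\<Sum>b\<in>Basis. (f b \<bullet> y) *\<^sub>R f b)"

definition coord_proj :: "'n set \<Rightarrow> real^'n \<Rightarrow> real^'n" where
  "coord_proj J y = (\<chi> i. if i \<in> J then y $ i else 0)"

definition augmented_gram :: "'n set \<Rightarrow> ('a::euclidean_space \<Rightarrow> real^'n) \<Rightarrow> real^'n \<Rightarrow> real^'n" where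
  "augmented_gram J f y = gram f y + coord_proj J y"

lemma linear_gram: "linear (gram f)"
  unfolding gram_def
  by (rule linearI)
     (simp_all add: inner_add_right scaleR_add_left sum.distrib scaleR_sum_right)

lemma linear_coord_proj: "linear (coord_proj J)"
  by (rule linearI) (simp_all add: coord_proj_def vec_eq_iff)

lemma linear_augmented_gram: "linear (augmented_gram J f)"
  unfolding augmented_gram_def
  by (intro linear_compose_add linear_gram linear_coord_proj)

lemma gram_eq_range:
  assumes "linear f"
  shows "gram f y = f (\<Sum>b\<in>Basis. (f b \<bullet> y) *\<^sub>R b)"
  by (simp add: gram_def linear_sum[OF assms] linear_scale[OF assms])

text \<open>Both summands of \<open>augmented_gram\<close> are positive semidefinite, so the kernel is the intersection of
  their kernels.\<close>

lemma augmented_gram_eq_0_iff: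
  assumes "linear f"
  shows "augmented_gram J f y = 0 \<longleftrightarrow> (\<forall>v. f v \<bullet> y = 0) \<and> (\<forall>j\<in>J. y $ j = 0)"
proof
  assume "augmented_gram J f y = 0"
  then have "augmented_gram J f y \<bullet> y = 0" by simp
  moreover have "gram f y \<bullet> y = (\<Sum>b\<in>Basis. (f b \<bullet> y)\<^sup>2)"
    by (simp add: gram_def inner_sum_left power2_eq_square)
  moreover have "coord_proj J y \<bullet> y = (\<Sum>j\<in>J. (y $ j)\<^sup>2)"
    by (simp add: coord_proj_def inner_vec_def power2_eq_square if_distrib[of "\<lambda>x. x * _"]
        sum.If_cases cong: if_cong)
  ultimately have "(\<Sum>b\<in>Basis. (f b \<bullet> y)\<^sup>2) + (\<Sum>j\<in>J. (y $ j)\<^sup>2) = 0"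
    by (simp add: augmented_gram_def inner_add_left)
  then have "(\<Sum>b\<in>Basis. (f b \<bullet> y)\<^sup>2) = 0" "(\<Sum>j\<in>J. (y $ j)\<^sup>2) = 0"
    by (auto simp: add_nonneg_eq_0_iff sum_nonneg)
  then have b: "\<forall>b\<in>Basis. f b \<bullet> y = 0" and J: "\<forall>j\<in>J. y $ j = 0"
    by (auto simp: sum_nonneg_eq_0_iff)
  have "f v \<bullet> y = 0" for v
  proof -
    have "f v = (\<Sum>b\<in>Basis. (v \<bullet> b) *\<^sub>R f b)"
      by (subst euclidean_representation[of v, symmetric])
         (simp only: linear_sum[OF assms] linear_scale[OF assms])
    then show ?thesis using b by (simp add: inner_sum_left)
  qed
  with J show "(\<forall>v. f v \<bullet> y = 0) \<and> (\<forall>j\<in>J. y $ j = 0)" by blast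
next
  assume "(\<forall>v. f v \<bullet> y = 0) \<and> (\<forall>j\<in>J. y $ j = 0)"
  then show "augmented_gram J f y = 0"
    by (simp add: augmented_gram_def gram_def coord_proj_def vec_eq_iff)
qed

text \<open>If the coordinate space of \<open>J\<close> met the range of \<open>f\<close> in a vector with a nonzero coordinate
  \<open>j\<close>, then \<open>j\<close> could be dropped from \<open>J\<close>.\<close>

lemma range_meets_coord_space_trivially:
  fixes f :: "'a::euclidean_space \<Rightarrow> real^'n"
  assumes f: "linear f" and inj: "inj (augmented_gram J f)"
    and minimal: "\<And>J'. inj (augmented_gram J' f) \<Longrightarrow> card J \<le> card J'"
    and v: "f v = coord_proj J y"
  shows "f v = 0"
proof (rule ccontr)
  assume "f v \<noteq> 0"
  then obtain j where j: "f v $ j \<noteq> 0" by (auto simp: vec_eq_iff)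
  then have jJ: "j \<in> J" using v by (auto simp: coord_proj_def split: if_splits)
  have "augmented_gram (J - {j}) f z = 0 \<Longrightarrow> z = 0" for z
  proof -
    assume "augmented_gram (J - {j}) f z = 0"
    then have z: "\<forall>v. f v \<bullet> z = 0" "\<forall>i\<in>J - {j}. z $ i = 0"
      by (simp_all add: augmented_gram_eq_0_iff[OF f])
    have "f v \<bullet> z = (\<Sum>i\<in>UNIV. f v $ i * z $ i)" by (simp add: inner_vec_def)
    also have "\<dots> = (\<Sum>i\<in>{j}. f v $ i * z $ i)"
      by (rule sum.mono_neutral_right) (use z(2) v in \<open>auto simp: coord_proj_def\<close>)
    finally have "z $ j = 0" using z(1) j by simp
    with z have "augmented_gram J f z = 0"
      by (auto simp: augmented_gram_eq_0_iff[OF f])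
    then show "z = 0"
      using inj unfolding linear_injective_0[OF linear_augmented_gram] by blast
  qed
  then have "inj (augmented_gram (J - {j}) f)"
    unfolding linear_injective_0[OF linear_augmented_gram] by blast
  from minimal[OF this] jJ show False
    using card_Diff1_less[of J j] by simp
qed

text \<open>The coordinate space of \<open>J\<close> is a complement of the range of \<open>f\<close>, so that \<open>augmented_gram J f\<close> is the sum of
  two maps into complementary subspaces and can be inverted on each of them separately.\<close>

locale coord_complement =
  fixes J :: "'n::finite set" and f :: "'a::euclidean_space \<Rightarrow> real^'n"
  assumes lin: "linear f" and inj: "inj (augmented_gram J f)"
    and trivial: "\<And>v y. f v = coord_proj J y \<Longrightarrow> f v = 0"
begin

abbreviation K where "K \<equiv> augmented_gram J f"

definition Kinv where "Kinv = inv K"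

lemma linear_K: "linear K" by (rule linear_augmented_gram)

lemma Kinv_K: "Kinv (K y) = y"
  using inj by (simp add: Kinv_def)

lemma K_Kinv: "K (Kinv x) = x"
  using surj_f_inv_f[OF linear_injective_imp_surjective[OF linear_K inj]]
  by (simp add: Kinv_def)

lemma linear_Kinv: "linear Kinv"
proof (rule linearI)
  show "Kinv (x + y) = Kinv x + Kinv y" for x y
    using Kinv_K[of "Kinv x + Kinv y"] by (simp add: linear_add[OF linear_K] K_Kinv)
  show "Kinv (r *\<^sub>R x) = r *\<^sub>R Kinv x" for r x
    using Kinv_K[of "r *\<^sub>R Kinv x"] by (simp add: linear_scale[OF linear_K] K_Kinv)
qed

definition P where "P x = gram f (Kinv x)"

lemma linear_P: "linear P"
  using linear_compose[OF linear_Kinv linear_gram[of f]] by (simp add: P_def[abs_def] o_def)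

lemma K_split: "K y = gram f y + coord_proj J y"
  by (simp add: augmented_gram_def)

lemma range_preimage:
  assumes "K y = f v"
  shows "gram f y = f v" "coord_proj J y = 0"
proof -
  have "f (v - (\<Sum>b\<in>Basis. (f b \<bullet> y) *\<^sub>R b)) = coord_proj J y"
    using assms K_split[of y] gram_eq_range[OF lin, of y]
    by (simp add: linear_diff[OF lin] algebra_simps)
  with trivial show "coord_proj J y = 0" by metis
  then show "gram f y = f v" using assms K_split[of y] by simp
qed

lemma P_coord_proj: "P (coord_proj J y) = 0"
proof -
  define z where "z = Kinv (coord_proj J y)"
  have "gram f z = coord_proj J (y - z)"
    using K_Kinv[of "coord_proj J y"] K_split[of z]
    by (simp add: z_def linear_diff[OF linear_coord_proj] algebra_simps)
  then have "gram f z = 0"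
    using trivial gram_eq_range[OF lin, of z] by metis
  then show ?thesis by (simp add: P_def z_def)
qed

lemma decompose: "\<exists>v y. x = f v + coord_proj J y"
proof -
  have "x = gram f (Kinv x) + coord_proj J (Kinv x)"
    using K_Kinv[of x] K_split[of "Kinv x"] by simp
  then show ?thesis unfolding gram_eq_range[OF lin] by blast
qed

end


section \<open>The flow of a linear vector field\<close>

text \<open>This is \<open>exp (t A) x\<close>. Each coordinate is a power series in \<open>t\<close> with real coefficients, which can be
  differentiated termwise.\<close>

definition exp_flow :: "('a::euclidean_space \<Rightarrow> 'a) \<Rightarrow> real \<Rightarrow> 'a \<Rightarrow> 'a" where
  "exp_flow A t x = (\<Sum>b\<in>Basis. (\<Sum>n. ((A ^^ n) x \<bullet> b / fact n) * t ^ n) *\<^sub>R b)"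

lemma linear_funpow:
  fixes A :: "'a::real_vector \<Rightarrow> 'a"
  assumes "linear A"
  shows "linear (A ^^ n)"
proof (induction n)
  case 0
  show ?case by (simp add: linear_iff)
next
  case (Suc n)
  then show ?case using linear_compose[OF Suc assms] by (simp add: o_def)
qed

lemma norm_funpow_le:
  fixes A :: "'a::real_normed_vector \<Rightarrow> 'a"
  assumes "\<And>x. norm (A x) \<le> B * norm x" "B \<ge> 0"
  shows "norm ((A ^^ n) x) \<le> B ^ n * norm x"
proof (induction n)
  case (Suc n)
  have "norm ((A ^^ Suc n) x) \<le> B * norm ((A ^^ n) x)" using assms(1) by simp
  also have "\<dots> \<le> B * (B ^ n * norm x)" using Suc assms(2) by (rule mult_left_mono)
  finally show ?case by (simp add: mult.assoc)
qed simp

context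
  fixes A :: "'a::euclidean_space \<Rightarrow> 'a"
  assumes A: "linear A"
begin

lemma linear_obtain_bound:
  obtains B where "B \<ge> 0" "\<And>x. norm (A x) \<le> B * norm x"
proof -
  obtain B where "B > 0" "\<And>x. norm (A x) \<le> B * norm x"
    using linear_bounded_pos[OF A] by blast
  then show thesis by (intro that[of B]) auto
qed

lemma exp_series_bound:
  assumes "b \<in> Basis" "B \<ge> 0" "\<And>x. norm (A x) \<le> B * norm x"
  shows "norm (((A ^^ n) x \<bullet> b / fact n) * t ^ n) \<le> norm x * ((B * \<bar>t\<bar>) ^ n /\<^sub>R fact n)"
proof -
  have "\<bar>(A ^^ n) x \<bullet> b\<bar> \<le> B ^ n * norm x"
    using norm_funpow_le[of A B n x, OF assms(3,2)] Basis_le_norm[OF assms(1), of "(A ^^ n) x"]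
    by linarith
  then have "\<bar>(A ^^ n) x \<bullet> b\<bar> * (\<bar>t\<bar> ^ n / fact n) \<le> (B ^ n * norm x) * (\<bar>t\<bar> ^ n / fact n)"
    by (rule mult_right_mono) simp
  then show ?thesis
    by (simp add: abs_mult power_abs power_mult_distrib field_simps)
qed

lemma summable_exp_series:
  assumes "b \<in> Basis"
  shows "summable (\<lambda>n. ((A ^^ n) x \<bullet> b / fact n) * t ^ n)"
proof -
  obtain B where B: "B \<ge> 0" "\<And>x. norm (A x) \<le> B * norm x"
    using linear_obtain_bound by blast
  show ?thesis
    by (rule summable_comparison_test'[OF _ exp_series_bound[OF assms B]])
       (intro summable_mult summable_exp_generic)
qed

lemma exp_flow_inner:
  "b \<in> Basis \<Longrightarrow> exp_flow A t x \<bullet> b = (\<Sum>n. ((A ^^ n) x \<bullet> b / fact n) * t ^ n)"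
  unfolding exp_flow_def by simp

lemma exp_flow_0: "exp_flow A 0 x = x"
proof (rule euclidean_eqI)
  fix b :: 'a assume "b \<in> Basis"
  then show "exp_flow A 0 x \<bullet> b = x \<bullet> b"
    using powser_zero[of "\<lambda>n. (A ^^ n) x \<bullet> b / fact n"] by (simp add: exp_flow_inner)
qed

lemma linear_exp_flow: "linear (exp_flow A t)"
proof (rule linearI; rule euclidean_eqI)
  fix x y b :: 'a and r :: real
  assume b: "b \<in> Basis"
  note sums = exp_flow_inner[OF b] linear_add[OF linear_funpow[OF A]]
    linear_scale[OF linear_funpow[OF A]]
  show "exp_flow A t (x + y) \<bullet> b = (exp_flow A t x + exp_flow A t y) \<bullet> b"
    unfolding sums inner_add_left add_divide_distrib distrib_right
    by (rule suminf_add[OF summable_exp_series[OF b] summable_exp_series[OF b], symmetric])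
  show "exp_flow A t (r *\<^sub>R x) \<bullet> b = (r *\<^sub>R exp_flow A t x) \<bullet> b"
    unfolding sums inner_scaleR_left times_divide_eq_right[symmetric] mult.assoc[of r]
    by (rule suminf_mult[OF summable_exp_series[OF b]])
qed

lemma exp_flow_has_vector_derivative:
  "((\<lambda>t. exp_flow A t x) has_vector_derivative exp_flow A t (A x)) (at t within S)"
proof -
  have "((\<lambda>t. \<Sum>n. ((A ^^ n) x \<bullet> b / fact n) * t ^ n) has_real_derivative
      (\<Sum>n. ((A ^^ n) (A x) \<bullet> b / fact n) * t ^ n)) (at t)" if "b \<in> Basis" for b
  proof -
    have "real (Suc n) * ((A ^^ Suc n) x \<bullet> b / fact (Suc n)) = (A ^^ n) (A x) \<bullet> b / fact n" for n
    proof -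
      have "(A ^^ Suc n) x = (A ^^ n) (A x)" unfolding funpow_Suc_right o_def ..
      moreover have "fact (Suc n) = real (Suc n) * fact n" by (rule fact_Suc)
      ultimately show ?thesis
        using nonzero_mult_divide_mult_cancel_left[of "real (Suc n)"] by simp
    qed
    then have "diffs (\<lambda>n. (A ^^ n) x \<bullet> b / fact n) = (\<lambda>n. (A ^^ n) (A x) \<bullet> b / fact n)"
      unfolding diffs_def of_nat_id by auto
    then show ?thesis
      using termdiffs_strong_converges_everywhere[of "\<lambda>n. (A ^^ n) x \<bullet> b / fact n" t,
          OF summable_exp_series[OF that]] by simp
  qed
  then have "((\<lambda>t. exp_flow A t x) has_vector_derivative exp_flow A t (A x)) (at t)"
    unfolding exp_flow_def
    by (intro has_vector_derivative_sum
        bounded_linear.has_vector_derivative[OF bounded_linear_scaleR_left])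
       (simp add: has_real_derivative_iff_has_vector_derivative)
  then show ?thesis by (rule has_vector_derivative_at_within)
qed

lemma exp_flow_crude_bound:
  obtains C a where "C \<ge> 0" "\<And>t x. t \<ge> 0 \<Longrightarrow> norm (exp_flow A t x) \<le> C * exp (a * t) * norm x"
proof -
  obtain B where B: "B \<ge> 0" "\<And>x. norm (A x) \<le> B * norm x"
    using linear_obtain_bound by blast
  have "norm (exp_flow A t x) \<le> real DIM('a) * exp (B * t) * norm x" if "t \<ge> 0" for t x
  proof -
    have "\<bar>exp_flow A t x \<bullet> b\<bar> \<le> exp (B * t) * norm x" if b: "b \<in> Basis" for b
    proof -
      let ?f = "\<lambda>n. ((A ^^ n) x \<bullet> b / fact n) * t ^ n"
      let ?g = "\<lambda>n. norm x * ((B * \<bar>t\<bar>) ^ n /\<^sub>R fact n)"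
      have le: "norm (?f n) \<le> ?g n" for n
        by (rule exp_series_bound[OF b B])
      have g: "summable ?g" by (intro summable_mult summable_exp_generic)
      have nf: "summable (\<lambda>n. norm (?f n))"
        by (rule summable_comparison_test'[OF g, of 0]) (use le in auto)
      have "norm (suminf ?f) \<le> (\<Sum>n. norm (?f n))" by (rule summable_norm[OF nf])
      also have "\<dots> \<le> suminf ?g" by (rule suminf_le[OF le nf g])
      also have "\<dots> = norm x * exp (B * \<bar>t\<bar>)"
        using suminf_mult[OF summable_exp_generic[of "B * \<bar>t\<bar>"], of "norm x"] by (simp add: exp_def)
      finally show ?thesis using b \<open>t \<ge> 0\<close> by (simp add: exp_flow_inner mult.commute)
    qed
    then have "(\<Sum>b\<in>Basis. \<bar>exp_flow A t x \<bullet> b\<bar>) \<le> (\<Sum>b\<in>(Basis::'a set). exp (B * t) * norm x)"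
      by (intro sum_mono)
    then show ?thesis using norm_le_l1[of "exp_flow A t x"] by simp
  qed
  then show thesis by (intro that[of "real DIM('a)" B]) auto
qed

lemma exp_flow_eigenvector:
  assumes "A x = - x"
  shows "exp_flow A t x = exp (- t) *\<^sub>R x"
proof -
  have "((\<lambda>t. exp t *\<^sub>R exp_flow A t x) has_vector_derivative 0) (at t within UNIV)" for t
  proof -
    have "((\<lambda>t. exp t *\<^sub>R exp_flow A t x) has_vector_derivative
        (exp t *\<^sub>R exp_flow A t (A x) + exp t *\<^sub>R exp_flow A t x)) (at t within UNIV)"
      by (intro has_vector_derivative_scaleR DERIV_exp exp_flow_has_vector_derivative)
    then show ?thesis
      by (simp add: assms linear_neg[OF linear_exp_flow])
  qed
  then obtain c where c: "\<And>t. exp t *\<^sub>R exp_flow A t x = c"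
    using has_vector_derivative_zero_constant[of UNIV "\<lambda>t. exp t *\<^sub>R exp_flow A t x"] by auto
  from c[of 0] c[of t] have "exp t *\<^sub>R exp_flow A t x = x" by (simp add: exp_flow_0)
  then have "exp (- t) *\<^sub>R exp t *\<^sub>R exp_flow A t x = exp (- t) *\<^sub>R x" by simp
  then show ?thesis by (simp add: exp_minus)
qed

end


section \<open>The Lyapunov operator\<close>

text \<open>A tensor \<open>\<Sigma> s u \<otimes> w\<close> annihilated by the derivation \<open>A \<otimes> 1 + 1 \<otimes> A\<close> is constant along the
  flow of \<open>A\<close>; if the flow contracts, the tensor vanishes.\<close>

lemma invariant_tensor_eq_0:
  fixes A :: "real^'n \<Rightarrow> real^'n" and u w :: "'i \<Rightarrow> real^'n"
  assumes A: "linear A" and I: "finite I"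
    and decay: "\<And>x. ((\<lambda>t. exp_flow A t x) \<longlongrightarrow> 0) at_top"
    and inv: "\<And>i j. (\<Sum>r\<in>I. s r * (A (u r) $ i * w r $ j + u r $ i * A (w r) $ j)) = 0"
  shows "(\<Sum>r\<in>I. s r * ((a \<bullet> u r) * (b \<bullet> w r))) = 0"
proof -
  define \<phi> where "\<phi> t = (\<Sum>r\<in>I. s r * ((a \<bullet> exp_flow A t (u r)) * (b \<bullet> exp_flow A t (w r))))" for t
  have expand: "c \<bullet> exp_flow A t x = (\<Sum>i\<in>UNIV. x $ i * (c \<bullet> exp_flow A t (axis i 1)))" for c t x
  proof -
    have "exp_flow A t x = exp_flow A t (\<Sum>i\<in>UNIV. x $ i *\<^sub>R axis i 1)"
      by (simp add: basis_expansion scalar_mult_eq_scaleR[symmetric])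
    then show ?thesis
      by (simp add: linear_sum[OF linear_exp_flow[OF A]] linear_scale[OF linear_exp_flow[OF A]]
          inner_sum_right)
  qed
  have "(\<phi> has_real_derivative 0) (at t)" for t
  proof -
    have E: "((\<lambda>t. c \<bullet> exp_flow A t x) has_real_derivative c \<bullet> exp_flow A t (A x)) (at t)" for c x
      using bounded_linear.has_vector_derivative[OF bounded_linear_inner_right
          exp_flow_has_vector_derivative[OF A]]
      by (simp add: has_real_derivative_iff_has_vector_derivative)
    let ?e = "\<lambda>c i. c \<bullet> exp_flow A t (axis i 1)"
    have pair: "(a \<bullet> exp_flow A t x) * (b \<bullet> exp_flow A t y)
        = (\<Sum>i\<in>UNIV. \<Sum>j\<in>UNIV. ?e a i * ?e b j * (x $ i * y $ j))" for x y
      unfolding expand[of a t x] expand[of b t y] sum_product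
      by (intro sum.cong refl) (simp add: algebra_simps)
    have "(\<phi> has_real_derivative (\<Sum>r\<in>I. s r *
        ((a \<bullet> exp_flow A t (A (u r))) * (b \<bullet> exp_flow A t (w r))
         + (b \<bullet> exp_flow A t (A (w r))) * (a \<bullet> exp_flow A t (u r))))) (at t)"
      unfolding \<phi>_def by (intro DERIV_sum DERIV_cmult DERIV_mult E)
    also have "(\<Sum>r\<in>I. s r *
        ((a \<bullet> exp_flow A t (A (u r))) * (b \<bullet> exp_flow A t (w r))
         + (b \<bullet> exp_flow A t (A (w r))) * (a \<bullet> exp_flow A t (u r))))
      = (\<Sum>r\<in>I. \<Sum>i\<in>UNIV. \<Sum>j\<in>UNIV. ?e a i * ?e b j *
          (s r * (A (u r) $ i * w r $ j + u r $ i * A (w r) $ j)))"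
    proof (intro sum.cong refl)
      fix r
      show "s r * ((a \<bullet> exp_flow A t (A (u r))) * (b \<bullet> exp_flow A t (w r))
           + (b \<bullet> exp_flow A t (A (w r))) * (a \<bullet> exp_flow A t (u r)))
        = (\<Sum>i\<in>UNIV. \<Sum>j\<in>UNIV. ?e a i * ?e b j *
            (s r * (A (u r) $ i * w r $ j + u r $ i * A (w r) $ j)))"
        unfolding mult.commute[of "b \<bullet> exp_flow A t (A (w r))"]
          pair[of "A (u r)" "w r"] pair[of "u r" "A (w r)"] sum.distrib[symmetric] sum_distrib_left
        by (intro sum.cong refl) (simp add: algebra_simps)
    qed
    also have "\<dots> = (\<Sum>i\<in>UNIV. \<Sum>j\<in>UNIV. ?e a i * ?e b j *
          (\<Sum>r\<in>I. s r * (A (u r) $ i * w r $ j + u r $ i * A (w r) $ j)))"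
      unfolding sum_distrib_left
      by (subst sum.swap) (intro sum.cong refl sum.swap)
    also have "\<dots> = 0" by (simp add: inv)
    finally show ?thesis .
  qed
  then have const: "\<phi> t = \<phi> 0" for t
    by (intro DERIV_isconst_all allI)
  have "(\<phi> \<longlongrightarrow> (\<Sum>r\<in>I. s r * ((a \<bullet> 0) * (b \<bullet> 0)))) at_top"
    unfolding \<phi>_def by (intro tendsto_intros decay)
  then have "(\<phi> \<longlongrightarrow> 0) at_top" by simp
  then have "((\<lambda>t. \<phi> 0) \<longlongrightarrow> 0) (at_top :: real filter)"
    by (rule Lim_transform_eventually) (rule always_eventually, rule allI, rule const)
  then have "\<phi> 0 = 0" by (simp add: tendsto_const_iff)
  then show ?thesis by (simp add: \<phi>_def exp_flow_0[OF A])
qed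

text \<open>The matrix of \<open>S \<mapsto> M S K\<^sup>T + K S M\<^sup>T\<close> in the entries of \<open>S\<close>. For invertible \<open>K\<close>, the substitution
  \<open>S' = K S K\<^sup>T\<close> turns it into the Lyapunov operator of \<open>M K\<^sup>-\<^sup>1\<close>, but its entries are polynomial in those of
  \<open>M\<close> and \<open>K\<close>.\<close>

definition lyapunov_matrix :: "real^'n^'n \<Rightarrow> real^'n^'n \<Rightarrow> real^('n \<times> 'n)^('n \<times> 'n)" where
  "lyapunov_matrix M K =
     (\<chi> r c. M $ fst r $ fst c * K $ snd r $ snd c + K $ fst r $ fst c * M $ snd r $ snd c)"

text \<open>For \<open>s\<close> in the kernel, the tensor \<open>K s K\<^sup>T\<close> is invariant under the flow of \<open>A\<close> and therefore
  vanishes; \<open>K\<close> can then be cancelled.\<close>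

lemma lyapunov_matrix_det_nonzero:
  fixes m k A :: "real^'n \<Rightarrow> real^'n"
  assumes k: "linear k" "inj k" and A: "linear A" and D: "D \<noteq> 0"
    and m: "\<And>y. m y = (- D) *\<^sub>R A (k y)"
    and decay: "\<And>x. ((\<lambda>t. exp_flow A t x) \<longlongrightarrow> 0) at_top"
  shows "det (lyapunov_matrix (matrix m) (matrix k)) \<noteq> 0"
proof -
  let ?L = "lyapunov_matrix (matrix m) (matrix k)"
  have "s = 0" if s: "?L *v s = 0" for s
  proof -
    let ?u = "\<lambda>r::'n \<times> 'n. k (axis (fst r) 1)" and ?w = "\<lambda>r::'n \<times> 'n. k (axis (snd r) 1)"
    have "(\<Sum>r\<in>UNIV. s $ r * (A (?u r) $ i * ?w r $ j + ?u r $ i * A (?w r) $ j)) = 0" for i j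
    proof -
      have "0 = (?L *v s) $ (i, j)" using s by simp
      also have "\<dots> = (\<Sum>r\<in>UNIV. - D * (s $ r * (A (?u r) $ i * ?w r $ j + ?u r $ i * A (?w r) $ j)))"
        unfolding matrix_vector_mult_def lyapunov_matrix_def matrix_def
        by (simp add: m, intro sum.cong refl) (simp add: algebra_simps)
      finally show ?thesis using D unfolding sum_distrib_left[symmetric] by simp
    qed
    then have zero: "(\<Sum>r\<in>UNIV. s $ r * ((a \<bullet> ?u r) * (b \<bullet> ?w r))) = 0" for a b
      by (intro invariant_tensor_eq_0[OF A finite decay])
    obtain g where g: "linear g" "\<And>y. g (k y) = y"
      using linear_injective_left_inverse[OF k] by (metis comp_apply id_apply)
    have "s $ (p, q) = 0" for p q
    proof -
      \<comment> \<open>Pairing the vanishing tensor with these functionals undoes \<open>k\<close> on both sides.\<close>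
      let ?a = "adjoint g (axis p 1)" and ?b = "adjoint g (axis q 1)"
      have "?a \<bullet> k y = y $ p" "?b \<bullet> k y = y $ q" for y
        using adjoint_clauses(2)[OF g(1)] g(2) by (simp_all add: inner_axis' )
      then have "s $ r * ((?a \<bullet> ?u r) * (?b \<bullet> ?w r)) = (if r = (p, q) then s $ r else 0)" for r
        by (cases r) (auto simp: axis_def)
      then show ?thesis using zero[of ?a ?b] by simp
    qed
    then show "s = 0" by (auto simp: vec_eq_iff)
  qed
  then have "\<exists>B. B ** ?L = mat 1"
    by (simp add: matrix_left_invertible_ker)
  then show ?thesis
    by (simp add: invertible_left_inverse[symmetric] invertible_det_nz)
qed

text \<open>The real and imaginary parts \<open>x\<close>, \<open>y\<close> of an eigenvector for an imaginary eigenvalue yield the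
  kernel element \<open>x x\<^sup>T + y y\<^sup>T\<close> of the Lyapunov operator.\<close>

lemma lyapunov_matrix_no_imaginary_pair:
  fixes m k :: "real^'n \<Rightarrow> real^'n"
  assumes det: "det (lyapunov_matrix (matrix m) (matrix k)) \<noteq> 0"
    and lin: "linear m" "linear k"
    and a: "m a = (- w) *\<^sub>R k b" and b: "m b = w *\<^sub>R k a"
  shows "a = 0" "b = 0"
proof -
  let ?L = "lyapunov_matrix (matrix m) (matrix k)"
  define s :: "real^('n \<times> 'n)" where "s = (\<chi> c. a $ fst c * a $ snd c + b $ fst c * b $ snd c)"
  have expand: "f x $ i = (\<Sum>j\<in>UNIV. f (axis j 1) $ i * x $ j)"
    if "linear f" for f :: "real^'n \<Rightarrow> real^'n" and x i
  proof -
    have "f x = f (\<Sum>j\<in>UNIV. x $ j *\<^sub>R axis j 1)"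
      by (simp add: basis_expansion scalar_mult_eq_scaleR[symmetric])
    then show ?thesis
      by (simp add: linear_sum[OF that] linear_scale[OF that] mult.commute)
  qed
  have pairs: "(\<Sum>c\<in>UNIV. f (axis (fst c) 1) $ i * g (axis (snd c) 1) $ j * (x $ fst c * y $ snd c))
      = f x $ i * g y $ j" if "linear f" "linear g" for f g :: "real^'n \<Rightarrow> real^'n" and x y i j
    unfolding expand[OF that(1), of x i] expand[OF that(2), of y j] sum_product
      UNIV_Times_UNIV[symmetric] sum.cartesian_product
    by (intro sum.cong refl) (auto simp: algebra_simps)
  have "(?L *v s) $ r = 0" for r
  proof -
    obtain i j where r: "r = (i, j)" by (cases r)
    have "(?L *v s) $ r = m a $ i * k a $ j + m b $ i * k b $ j + k a $ i * m a $ j + k b $ i * m b $ j"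
      unfolding pairs[OF lin, of i j a a, symmetric] pairs[OF lin, of i j b b, symmetric]
        pairs[OF lin(2,1), of i j a a, symmetric] pairs[OF lin(2,1), of i j b b, symmetric]
        sum.distrib[symmetric]
      by (simp add: r s_def matrix_vector_mult_def lyapunov_matrix_def matrix_def,
          intro sum.cong refl) (simp add: algebra_simps)
    then show ?thesis by (simp add: a b)
  qed
  then have "?L *v s = 0" by (simp add: vec_eq_iff)
  moreover have "\<exists>B. B ** ?L = mat 1"
    using det by (simp add: invertible_left_inverse[symmetric] invertible_det_nz)
  ultimately have "s = 0" by (simp add: matrix_left_invertible_ker)
  then have "s $ (i, i) = 0" for i by simp
  then have "a $ i * a $ i + b $ i * b $ i = 0" for i
    unfolding s_def by simp
  then have "a $ i = 0 \<and> b $ i = 0" for i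
    by (simp add: sum_squares_eq_zero_iff)
  then show "a = 0" "b = 0" by (simp_all add: vec_eq_iff)
qed


section \<open>Estimates for curves on the half line\<close>

lemma norm_increment_le:
  fixes f :: "real \<Rightarrow> 'a::real_normed_vector" and \<phi> :: "real \<Rightarrow> real"
  assumes T: "0 \<le> T"
    and f: "\<And>t. 0 \<le> t \<Longrightarrow> t \<le> T \<Longrightarrow> (f has_vector_derivative f' t) (at t within {0..T})"
    and \<phi>: "\<And>t. (\<phi> has_real_derivative \<phi>' t) (at t)"
    and le: "\<And>t. 0 < t \<Longrightarrow> t < T \<Longrightarrow> norm (f' t) \<le> \<phi>' t"
  shows "norm (f T - f 0) \<le> \<phi> T - \<phi> 0"
proof (cases "T = 0")
  case False
  show ?thesis
  proof (rule differentiable_bound_general)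
    show "0 < T" using T False by simp
    show "continuous_on {0..T} f"
      by (rule continuous_on_vector_derivative) (use f in auto)
    show "continuous_on {0..T} \<phi>"
      using \<phi> DERIV_isCont continuous_at_imp_continuous_on by blast
    show "(f has_vector_derivative f' t) (at t)" if "0 < t" "t < T" for t
      using f[of t] that by (simp add: at_within_Icc_at)
    show "(\<phi> has_vector_derivative \<phi>' t) (at t)" for t
      using \<phi> by (simp add: has_real_derivative_iff_has_vector_derivative)
  qed (rule le)
qed simp

lemma norm_le_exponential_growth:
  fixes x :: "real \<Rightarrow> 'a::real_inner"
  assumes T: "0 \<le> T"
    and x: "\<And>t. 0 \<le> t \<Longrightarrow> t \<le> T \<Longrightarrow> (x has_vector_derivative x' t) (at t within {0..T})"
    and le: "\<And>t. 0 < t \<Longrightarrow> t < T \<Longrightarrow> norm (x' t) \<le> L * norm (x t)"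
  shows "norm (x T) \<le> norm (x 0) * exp (L * T)"
proof -
  \<comment> \<open>The squared norm is differentiable also where \<open>x\<close> vanishes.\<close>
  define y where "y t = (x t \<bullet> x t) * exp (- 2 * L * t)" for t
  have cont: "continuous_on {0..T} x"
    by (rule continuous_on_vector_derivative) (use x in auto)
  have "y 0 \<ge> y T"
  proof (rule DERIV_nonpos_imp_decreasing_open[OF T])
    show "continuous_on {0..T} y"
      unfolding y_def by (intro continuous_intros cont)
    fix t assume t: "0 < t" "t < T"
    have "(x has_vector_derivative x' t) (at t)"
      using x[of t] t by (simp add: at_within_Icc_at)
    then have "((\<lambda>t. x t \<bullet> x t) has_real_derivative (x t \<bullet> x' t + x' t \<bullet> x t)) (at t)"
      unfolding has_real_derivative_iff_has_vector_derivative
      by (intro bounded_bilinear.has_vector_derivative[OF bounded_bilinear_inner])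
    then have "(y has_real_derivative
        ((x t \<bullet> x' t + x' t \<bullet> x t) * exp (- 2 * L * t)
          + exp (- 2 * L * t) * (- 2 * L) * (x t \<bullet> x t))) (at t)"
      unfolding y_def
      by (rule DERIV_mult) (auto intro!: derivative_eq_intros)
    moreover have "(x t \<bullet> x' t + x' t \<bullet> x t) * exp (- 2 * L * t)
          + exp (- 2 * L * t) * (- 2 * L) * (x t \<bullet> x t)
        = (2 * exp (- 2 * L * t)) * (x t \<bullet> x' t - L * (x t \<bullet> x t))"
      by (simp add: inner_commute[of "x' t"] algebra_simps)
    moreover have "x t \<bullet> x' t \<le> L * (x t \<bullet> x t)"
    proof -
      have "x t \<bullet> x' t \<le> norm (x t) * norm (x' t)" by (rule norm_cauchy_schwarz)
      also have "\<dots> \<le> norm (x t) * (L * norm (x t))"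
        by (rule mult_left_mono[OF le[OF t]]) simp
      finally show ?thesis by (simp add: dot_square_norm power2_eq_square algebra_simps)
    qed
    ultimately show "\<exists>D. (y has_real_derivative D) (at t) \<and> D \<le> 0"
      by (metis diff_le_0_iff_le exp_ge_zero mult_nonneg_nonpos zero_le_mult_iff zero_le_numeral)
  qed
  then have "(norm (x T))\<^sup>2 * exp (- 2 * L * T) \<le> (norm (x 0))\<^sup>2"
    by (simp add: y_def dot_square_norm)
  then have "(norm (x T))\<^sup>2 * exp (- 2 * L * T) * exp (2 * L * T) \<le> (norm (x 0))\<^sup>2 * exp (2 * L * T)"
    by (rule mult_right_mono) simp
  also have "exp (2 * L * T) = (exp (L * T))\<^sup>2"
    by (simp add: exp_double[symmetric] mult.assoc)
  finally have "(norm (x T))\<^sup>2 \<le> (norm (x 0) * exp (L * T))\<^sup>2"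
    by (simp add: power_mult_distrib mult.assoc flip: exp_double exp_add)
  then show ?thesis
    by (rule power2_le_imp_le) simp
qed

text \<open>Variation of constants: transported to the final time \<open>t\<close> by the linear flow, the curve moves only by
  its deviation from the linear equation.\<close>

lemma exp_flow_duhamel_derivative:
  fixes A :: "'a::euclidean_space \<Rightarrow> 'a"
  assumes A: "linear A" and x: "(x has_vector_derivative x') (at s within S)"
  shows "((\<lambda>s. exp_flow A (t - s) (x s)) has_vector_derivative exp_flow A (t - s) (x' - A (x s)))
    (at s within S)"
proof -
  note E = linear_exp_flow[OF A]
  have expand: "exp_flow A r z = (\<Sum>b\<in>Basis. (z \<bullet> b) *\<^sub>R exp_flow A r b)" for r z
    by (subst (1) euclidean_representation[of z, symmetric])
       (simp only: linear_sum[OF E] linear_scale[OF E])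
  have flow: "((\<lambda>s. exp_flow A (t - s) b) has_vector_derivative - exp_flow A (t - s) (A b))
      (at s within S)" for b
  proof -
    have "((\<lambda>s. t - s) has_vector_derivative - 1) (at s within S)"
      by (auto intro!: derivative_eq_intros)
    from vector_diff_chain_within[OF this exp_flow_has_vector_derivative[OF A, of b]]
    show ?thesis by (simp add: o_def)
  qed
  have coord: "((\<lambda>s. x s \<bullet> b) has_real_derivative (x' \<bullet> b)) (at s within S)" for b
    using bounded_linear.has_vector_derivative[OF bounded_linear_inner_left x]
    by (simp add: has_real_derivative_iff_has_vector_derivative)
  have "((\<lambda>s. \<Sum>b\<in>Basis. (x s \<bullet> b) *\<^sub>R exp_flow A (t - s) b) has_vector_derivative
      (\<Sum>b\<in>Basis. (x s \<bullet> b) *\<^sub>R (- exp_flow A (t - s) (A b)) + (x' \<bullet> b) *\<^sub>R exp_flow A (t - s) b))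
      (at s within S)"
    by (intro has_vector_derivative_sum has_vector_derivative_scaleR coord flow)
  moreover have "(\<Sum>b\<in>Basis. (x s \<bullet> b) *\<^sub>R (- exp_flow A (t - s) (A b)) + (x' \<bullet> b) *\<^sub>R exp_flow A (t - s) b)
      = exp_flow A (t - s) (x' - A (x s))"
  proof -
    have "A (x s) = (\<Sum>b\<in>Basis. (x s \<bullet> b) *\<^sub>R A b)"
      by (subst (1) euclidean_representation[of "x s", symmetric])
         (simp only: linear_sum[OF A] linear_scale[OF A])
    then have "exp_flow A (t - s) (A (x s)) = (\<Sum>b\<in>Basis. (x s \<bullet> b) *\<^sub>R exp_flow A (t - s) (A b))"
      by (simp only: linear_sum[OF E] linear_scale[OF E])
    then show ?thesis
      by (simp add: linear_diff[OF E] expand[of _ x'] sum.distrib sum_negf sum_subtractf)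
  qed
  ultimately show ?thesis
    by (simp only: expand[symmetric])
qed

text \<open>\<open>x\<close> solves the linear equation for \<open>A\<close> up to an error \<open>\<epsilon> |x|\<close>. Weighting with \<open>exp (- a t)\<close>
  replaces Gronwall's lemma: at its maximum over the interval the weighted norm is bounded by the
  initial value plus \<open>T C \<epsilon>\<close> times itself.\<close>

lemma exp_flow_perturbation:
  fixes A :: "'a::euclidean_space \<Rightarrow> 'a"
  assumes A: "linear A" and C: "C \<ge> 0"
    and E: "\<And>t x. t \<ge> 0 \<Longrightarrow> norm (exp_flow A t x) \<le> C * exp (a * t) * norm x"
    and T: "0 \<le> T"
    and x: "\<And>t. 0 \<le> t \<Longrightarrow> t \<le> T \<Longrightarrow> (x has_vector_derivative x' t) (at t within {0..T})"
    and close: "\<And>t. 0 \<le> t \<Longrightarrow> t \<le> T \<Longrightarrow> norm (x' t - A (x t)) \<le> \<epsilon> * norm (x t)"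
    and \<epsilon>: "\<epsilon> \<ge> 0" "T * C * \<epsilon> \<le> 1 / 2"
  shows "norm (x T - exp_flow A T (x 0)) \<le> 2 * T * C\<^sup>2 * \<epsilon> * exp (a * T) * norm (x 0)"
proof -
  have contx: "continuous_on {0..T} x"
    by (rule continuous_on_vector_derivative) (use x in auto)
  then have "continuous_on {0..T} (\<lambda>t. norm (x t) * exp (- a * t))"
    by (intro continuous_intros)
  then obtain t1 where t1: "t1 \<in> {0..T}"
    and max: "\<And>t. t \<in> {0..T} \<Longrightarrow> norm (x t) * exp (- a * t) \<le> norm (x t1) * exp (- a * t1)"
    using continuous_attains_sup[of "{0..T}" "\<lambda>t. norm (x t) * exp (- a * t)"] T by auto
  define \<mu> where "\<mu> = norm (x t1) * exp (- a * t1)"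
  have \<mu>: "\<mu> \<ge> 0" by (simp add: \<mu>_def)
  have xle: "norm (x t) \<le> \<mu> * exp (a * t)" if "0 \<le> t" "t \<le> T" for t
  proof -
    have "norm (x t) = (norm (x t) * exp (- a * t)) * exp (a * t)"
      by (simp add: mult.assoc flip: exp_add)
    also have "\<dots> \<le> \<mu> * exp (a * t)"
      using max[of t] that by (intro mult_right_mono) (auto simp: \<mu>_def)
    finally show ?thesis .
  qed
  have dev: "norm (x t - exp_flow A t (x 0)) \<le> T * C * \<epsilon> * \<mu> * exp (a * t)"
    if t: "0 \<le> t" "t \<le> T" for t
  proof -
    let ?M = "C * \<epsilon> * \<mu> * exp (a * t)"
    have "norm (exp_flow A (t - t) (x t) - exp_flow A (t - 0) (x 0)) \<le> ?M * t - ?M * 0"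
    proof (rule norm_increment_le[OF t(1), where f' = "\<lambda>s. exp_flow A (t - s) (x' s - A (x s))"
          and \<phi>' = "\<lambda>_. ?M"])
      fix s assume s: "0 \<le> s" "s \<le> t"
      have "(x has_vector_derivative x' s) (at s within {0..t})"
        by (rule has_vector_derivative_within_subset[OF x]) (use s t in auto)
      then show "((\<lambda>s. exp_flow A (t - s) (x s)) has_vector_derivative
          exp_flow A (t - s) (x' s - A (x s))) (at s within {0..t})"
        by (rule exp_flow_duhamel_derivative[OF A])
    next
      fix s assume s: "0 < s" "s < t"
      have "norm (exp_flow A (t - s) (x' s - A (x s)))
          \<le> C * exp (a * (t - s)) * norm (x' s - A (x s))"
        using s by (intro E) simp
      also have "\<dots> \<le> C * exp (a * (t - s)) * (\<epsilon> * (\<mu> * exp (a * s)))"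
        using close[of s] mult_left_mono[OF xle[of s] \<epsilon>(1)] s t C
        by (intro mult_left_mono) auto
      also have "\<dots> = C * \<epsilon> * \<mu> * (exp (a * (t - s)) * exp (a * s))" by simp
      also have "\<dots> = ?M"
        by (simp add: algebra_simps flip: exp_add)
      finally show "norm (exp_flow A (t - s) (x' s - A (x s))) \<le> ?M" .
    qed (auto intro!: derivative_eq_intros)
    then have "norm (x t - exp_flow A t (x 0)) \<le> ?M * t"
      by (simp add: exp_flow_0[OF A])
    also have "\<dots> \<le> ?M * T"
      using t C \<epsilon>(1) \<mu> by (intro mult_left_mono) auto
    finally show ?thesis by (simp add: algebra_simps)
  qed
  have "norm (x t1) \<le> norm (x t1 - exp_flow A t1 (x 0)) + norm (exp_flow A t1 (x 0))"
    using norm_triangle_sub[of "x t1" "exp_flow A t1 (x 0)"] by simp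
  also have "\<dots> \<le> T * C * \<epsilon> * \<mu> * exp (a * t1) + C * exp (a * t1) * norm (x 0)"
    using t1 by (intro add_mono dev E) auto
  finally have "norm (x t1) * exp (- a * t1)
      \<le> (T * C * \<epsilon> * \<mu> * exp (a * t1) + C * exp (a * t1) * norm (x 0)) * exp (- a * t1)"
    by (rule mult_right_mono) simp
  also have "\<dots> = T * C * \<epsilon> * \<mu> + C * norm (x 0)"
    by (simp add: algebra_simps flip: exp_add)
  finally have "\<mu> \<le> T * C * \<epsilon> * \<mu> + C * norm (x 0)" by (simp add: \<mu>_def)
  moreover have "T * C * \<epsilon> * \<mu> \<le> 1 / 2 * \<mu>"
    using \<epsilon>(2) \<mu> by (rule mult_right_mono)
  ultimately have "\<mu> \<le> 2 * C * norm (x 0)" by simp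
  then have "T * C * \<epsilon> * \<mu> * exp (a * T) \<le> T * C * \<epsilon> * (2 * C * norm (x 0)) * exp (a * T)"
    using T C \<epsilon>(1) by (intro mult_right_mono mult_left_mono) auto
  with dev[OF T order_refl] show ?thesis
    by (simp add: power2_eq_square algebra_simps)
qed


section \<open>Exponential convergence forces a contracting linearization\<close>

text \<open>\<open>V\<close> and \<open>X\<close> are the velocities of \<open>p\<close> and of \<open>F p\<close>. The latter is \<open>A\<close> applied to the error
  \<open>F p - F z\<close>, up to a coefficient of order \<open>|p - z|\<close>. The bound \<open>N exp (- c t)\<close> does not improve
  with a smaller initial error, so the linearized error need not inherit it by rescaling.\<close>

locale exponentially_attracted =
  fixes F :: "'a::euclidean_space \<Rightarrow> 'b::euclidean_space"
    and V :: "'a \<Rightarrow> 'a" and X :: "'a \<Rightarrow> 'b"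
    and F' :: "'a \<Rightarrow> 'b" and A :: "'b \<Rightarrow> 'b"
    and z :: 'a and \<rho> L N c :: real
  assumes pos: "\<rho> > 0" "L > 0" "N > 0" "c > 0"
    and linear_F': "linear F'" and linear_A: "linear A"
    and F_diff: "\<And>p. p \<in> ball z \<rho> \<Longrightarrow> norm (F p - F z - F' (p - z)) \<le> L * (norm (p - z))\<^sup>2"
    and V_bound: "\<And>p. p \<in> ball z \<rho> \<Longrightarrow> norm (V p) \<le> L * norm (F p - F z)"
    and X_bound: "\<And>p. p \<in> ball z \<rho> \<Longrightarrow> norm (X p) \<le> L * norm (F p - F z)"
    and X_diff: "\<And>p. p \<in> ball z \<rho> \<Longrightarrow>
      norm (X p - A (F p - F z)) \<le> L * norm (p - z) * norm (F p - F z)"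
    and trajectory: "\<And>p0. p0 \<in> ball z \<rho> \<Longrightarrow> \<exists>p. p 0 = p0 \<and> (\<forall>t\<ge>0.
      (p has_vector_derivative V (p t)) (at t within {0..}) \<and>
      ((\<lambda>t. F (p t)) has_vector_derivative X (p t)) (at t within {0..}) \<and>
      norm (F (p t) - F z) \<le> N * exp (- c * t))"
begin

definition solution :: "(real \<Rightarrow> 'a) \<Rightarrow> bool" where
  "solution p \<longleftrightarrow> (\<forall>t\<ge>0.
      (p has_vector_derivative V (p t)) (at t within {0..}) \<and>
      ((\<lambda>t. F (p t)) has_vector_derivative X (p t)) (at t within {0..}) \<and>
      norm (F (p t) - F z) \<le> N * exp (- c * t))"

text \<open>The weight for which the mean of the exponents \<open>L\<close> and \<open>- c\<close> is \<open>- c / 2\<close>.\<close>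

definition \<theta> where "\<theta> = c / (2 * (L + c))"

lemma \<theta>: "0 < \<theta>" "\<theta> \<le> 1" "\<theta> * (L + c) = c / 2"
  using pos by (auto simp: \<theta>_def field_simps)

lemma solution_within:
  assumes "solution p" "0 \<le> t" "t \<le> T"
  shows "(p has_vector_derivative V (p t)) (at t within {0..T})"
    and "((\<lambda>t. F (p t) - F z) has_vector_derivative X (p t)) (at t within {0..T})"
proof -
  have p: "(p has_vector_derivative V (p t)) (at t within {0..})"
    "((\<lambda>t. F (p t)) has_vector_derivative X (p t)) (at t within {0..})"
    using assms by (auto simp: solution_def)
  show "(p has_vector_derivative V (p t)) (at t within {0..T})"
    by (rule has_vector_derivative_within_subset[OF p(1)]) auto
  have "((\<lambda>t. F (p t) - F z) has_vector_derivative X (p t) - 0) (at t within {0..})"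
    by (intro has_vector_derivative_diff p(2) has_vector_derivative_const)
  then have "((\<lambda>t. F (p t) - F z) has_vector_derivative X (p t)) (at t within {0..})" by simp
  then show "((\<lambda>t. F (p t) - F z) has_vector_derivative X (p t)) (at t within {0..T})"
    by (rule has_vector_derivative_within_subset) auto
qed

text \<open>The uniform decay \<open>N exp (- c t)\<close> does not see how small the initial error is, and growth at
  rate \<open>L\<close> from a small initial error does not decay. The geometric mean of the two bounds with
  weight \<open>\<theta>\<close> does both.\<close>

lemma error_decay:
  assumes p: "solution p" and T: "0 \<le> T"
    and stay: "\<And>t. 0 < t \<Longrightarrow> t < T \<Longrightarrow> p t \<in> ball z \<rho>"
    and init: "norm (F (p 0) - F z) \<le> C * exp (- \<tau>)" and C: "N \<le> C"
  shows "norm (F (p T) - F z) \<le> C * exp (- \<theta> * \<tau> - c / 2 * T)"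
proof -
  have "norm (F (p T) - F z) \<le> norm (F (p 0) - F z) * exp (L * T)"
    by (rule norm_le_exponential_growth[OF T solution_within(2)[OF p]])
       (use stay X_bound in auto)
  also have "\<dots> \<le> C * exp (- \<tau>) * exp (L * T)"
    using init by (rule mult_right_mono) simp
  finally have 1: "norm (F (p T) - F z) \<le> C * exp (- \<tau> + L * T)"
    by (simp add: mult.assoc flip: exp_add)
  have "norm (F (p T) - F z) \<le> N * exp (- c * T)"
    using p T by (simp add: solution_def)
  also have "\<dots> \<le> C * exp (- c * T)"
    using C by (rule mult_right_mono) simp
  finally have 2: "norm (F (p T) - F z) \<le> C * exp (- c * T)" .
  have C0: "C \<ge> 0" using C pos by simp
  have "min (- \<tau> + L * T) (- c * T) \<le> \<theta> * (- \<tau> + L * T) + (1 - \<theta>) * (- c * T)"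
  proof -
    have "\<theta> * min (- \<tau> + L * T) (- c * T) \<le> \<theta> * (- \<tau> + L * T)"
      by (rule mult_left_mono) (use \<theta> in auto)
    moreover have "(1 - \<theta>) * min (- \<tau> + L * T) (- c * T) \<le> (1 - \<theta>) * (- c * T)"
      by (rule mult_left_mono) (use \<theta> in auto)
    ultimately show ?thesis by (simp add: algebra_simps)
  qed
  also have "\<dots> = - \<theta> * \<tau> + (\<theta> * (L + c)) * T - c * T"
    by (simp add: algebra_simps)
  also have "\<dots> = - \<theta> * \<tau> - c / 2 * T"
    unfolding \<theta>(3) by (simp add: algebra_simps)
  finally have "exp (min (- \<tau> + L * T) (- c * T)) \<le> exp (- \<theta> * \<tau> - c / 2 * T)"
    by simp
  then have "C * exp (min (- \<tau> + L * T) (- c * T)) \<le> C * exp (- \<theta> * \<tau> - c / 2 * T)"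
    using C0 by (rule mult_left_mono)
  with 1 2 show ?thesis by (auto simp: min_def split: if_splits)
qed

text \<open>Since the velocity is bounded by the error, its integral and thus the whole displacement is
  small with the initial error.\<close>

lemma displacement_bound:
  assumes p: "solution p" and T: "0 \<le> T"
    and stay: "\<And>t. 0 < t \<Longrightarrow> t < T \<Longrightarrow> p t \<in> ball z \<rho>"
    and init: "norm (F (p 0) - F z) \<le> C * exp (- \<tau>)" and C: "N \<le> C"
  shows "norm (p T - p 0) \<le> 2 * L * C / c * exp (- \<theta> * \<tau>)"
proof -
  define \<phi> where "\<phi> t = - (2 * L * C / c) * exp (- \<theta> * \<tau> - c / 2 * t)" for t
  have "norm (p T - p 0) \<le> \<phi> T - \<phi> 0"
  proof (rule norm_increment_le[OF T solution_within(1)[OF p]])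
    show "(\<phi> has_real_derivative L * C * exp (- \<theta> * \<tau> - c / 2 * t)) (at t)" for t
      unfolding \<phi>_def using pos by (auto intro!: derivative_eq_intros)
    fix t assume t: "0 < t" "t < T"
    have "norm (V (p t)) \<le> L * norm (F (p t) - F z)"
      using stay[OF t] by (rule V_bound)
    also have "\<dots> \<le> L * (C * exp (- \<theta> * \<tau> - c / 2 * t))"
      using t stay pos by (intro mult_left_mono error_decay[OF p _ _ init C]) auto
    finally show "norm (V (p t)) \<le> L * C * exp (- \<theta> * \<tau> - c / 2 * t)" by simp
  qed
  also have "\<dots> \<le> - \<phi> 0"
    using pos C by (simp add: \<phi>_def)
  finally show ?thesis by (simp add: \<phi>_def)
qed

text \<open>A continuity argument: the bound on the displacement holds as long as the trajectory is in the
  ball, and it keeps the trajectory away from the boundary.\<close>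

lemma stays_close:
  assumes M: "M \<ge> 0"
  obtains C D \<tau>0 where "C \<ge> 0" "D \<ge> 0"
    and "\<And>p \<tau>. solution p \<Longrightarrow> norm (p 0 - z) \<le> M * exp (- \<tau>) \<Longrightarrow> \<tau> \<ge> \<tau>0 \<Longrightarrow>
      norm (F (p 0) - F z) \<le> C * exp (- \<tau>) \<and> p 0 \<in> ball z \<rho> \<and>
      (\<forall>t\<ge>0. p t \<in> ball z \<rho> \<and> norm (p t - z) \<le> D * exp (- \<theta> * \<tau>))"
proof -
  obtain B where B: "B > 0" "\<And>v. norm (F' v) \<le> B * norm v"
    using linear_bounded_pos[OF linear_F'] by blast
  define C where "C = max N (B * M + L * M\<^sup>2)"
  define D where "D = M + 2 * L * C / c"
  have C: "N \<le> C" "C \<ge> 0" using pos by (auto simp: C_def)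
  have D: "D \<ge> M" "D \<ge> 0" using M C pos by (auto simp: D_def)
  have "((\<lambda>\<tau>. D * exp (- \<theta> * \<tau>)) \<longlongrightarrow> D * 0) at_top"
    using \<theta> by (intro tendsto_mult tendsto_const filterlim_compose[OF exp_at_bot])
       (simp add: filterlim_uminus_at_bot filterlim_tendsto_pos_mult_at_top[OF tendsto_const]
          filterlim_ident)
  then have "eventually (\<lambda>\<tau>. D * exp (- \<theta> * \<tau>) < \<rho>) at_top"
    using pos by (intro order_tendstoD(2)) auto
  then obtain \<tau>1 where \<tau>1: "\<And>\<tau>. \<tau> \<ge> \<tau>1 \<Longrightarrow> D * exp (- \<theta> * \<tau>) < \<rho>"
    by (auto simp: eventually_at_top_linorder)
  have main: "norm (F (p 0) - F z) \<le> C * exp (- \<tau>) \<and> p 0 \<in> ball z \<rho> \<and>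
      (\<forall>t\<ge>0. p t \<in> ball z \<rho> \<and> norm (p t - z) \<le> D * exp (- \<theta> * \<tau>))"
    if p: "solution p" and p0: "norm (p 0 - z) \<le> M * exp (- \<tau>)" and \<tau>: "\<tau> \<ge> max \<tau>1 0" for p \<tau>
  proof -
    have "\<theta> * \<tau> \<le> 1 * \<tau>"
      using \<theta> \<tau> by (intro mult_right_mono) auto
    then have exp_le: "exp (- \<tau>) \<le> exp (- \<theta> * \<tau>)" by simp
    have small: "D * exp (- \<theta> * \<tau>) < \<rho>" using \<tau>1 \<tau> by simp
    have "M * exp (- \<tau>) \<le> D * exp (- \<theta> * \<tau>)"
      using exp_le D M by (intro mult_mono) auto
    then have in0: "p 0 \<in> ball z \<rho>"
      using p0 small by (simp add: dist_norm norm_minus_commute)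
    have init: "norm (F (p 0) - F z) \<le> C * exp (- \<tau>)"
    proof -
      have "norm (F (p 0) - F z) \<le> norm (F (p 0) - F z - F' (p 0 - z)) + norm (F' (p 0 - z))"
        using norm_triangle_sub[of "F (p 0) - F z" "F' (p 0 - z)"] by simp
      also have "\<dots> \<le> L * (norm (p 0 - z))\<^sup>2 + B * norm (p 0 - z)"
        by (intro add_mono F_diff in0 B)
      also have "\<dots> \<le> L * (M * exp (- \<tau>))\<^sup>2 + B * (M * exp (- \<tau>))"
        using p0 pos B by (intro add_mono mult_left_mono power_mono) auto
      also have "\<dots> = (L * M\<^sup>2) * (exp (- \<tau>) * exp (- \<tau>)) + B * M * exp (- \<tau>)"
        by (simp add: power2_eq_square)
      also have "\<dots> \<le> (L * M\<^sup>2) * (1 * exp (- \<tau>)) + B * M * exp (- \<tau>)"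
        using \<tau> pos by (intro add_right_mono mult_left_mono mult_right_mono) auto
      also have "\<dots> = (B * M + L * M\<^sup>2) * exp (- \<tau>)" by (simp add: algebra_simps)
      also have "\<dots> \<le> C * exp (- \<tau>)" by (intro mult_right_mono) (auto simp: C_def)
      finally show ?thesis .
    qed
    have near: "norm (p t - z) \<le> D * exp (- \<theta> * \<tau>)"
      if t: "0 \<le> t" and stay: "\<And>s. 0 < s \<Longrightarrow> s < t \<Longrightarrow> p s \<in> ball z \<rho>" for t
    proof -
      have "norm (p t - z) \<le> norm (p t - p 0) + norm (p 0 - z)"
        using norm_triangle_ineq[of "p t - p 0" "p 0 - z"] by simp
      also have "\<dots> \<le> 2 * L * C / c * exp (- \<theta> * \<tau>) + M * exp (- \<tau>)"
        by (intro add_mono displacement_bound[OF p t stay init C(1)] p0)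
      also have "\<dots> \<le> 2 * L * C / c * exp (- \<theta> * \<tau>) + M * exp (- \<theta> * \<tau>)"
        using exp_le M by (intro add_left_mono mult_left_mono)
      also have "\<dots> = D * exp (- \<theta> * \<tau>)" by (simp add: D_def algebra_simps)
      finally show ?thesis .
    qed
    have "p t \<in> ball z \<rho>" if "t \<ge> 0" for t
    proof (rule ccontr)
      assume "p t \<notin> ball z \<rho>"
      \<comment> \<open>The bound at the first exit time \<open>Inf S\<close> is a contradiction.\<close>
      define S where "S = {0..} \<inter> p -` (- ball z \<rho>)"
      have "continuous_on {0..} p"
        by (rule continuous_on_vector_derivative) (use p in \<open>auto simp: solution_def\<close>)
      then have "closed S"
        unfolding S_def by (intro continuous_closed_preimage) auto
      moreover have "t \<in> S" using that \<open>p t \<notin> ball z \<rho>\<close> by (simp add: S_def)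
      moreover have bdd: "bdd_below S" by (auto simp: S_def bdd_below_def)
      ultimately have inf: "Inf S \<in> S" using closed_contains_Inf by blast
      have "p s \<in> ball z \<rho>" if "0 < s" "s < Inf S" for s
        using cInf_lower[OF _ bdd, of s] that by (force simp: S_def)
      then have "norm (p (Inf S) - z) < \<rho>"
        using near[of "Inf S"] inf small by (auto simp: S_def)
      then show False
        using inf by (simp add: S_def dist_norm norm_minus_commute)
    qed
    then show ?thesis using near init in0 by auto
  qed
  show thesis
    by (rule that[OF C(2) D(2), of "max \<tau>1 0"]) (use main in blast)
qed

definition \<kappa> where "\<kappa> = \<theta> * c / 4"

lemma \<kappa>: "\<kappa> > 0" "\<kappa> \<le> c / 2"
proof -
  show "\<kappa> > 0" using \<theta> pos by (simp add: \<kappa>_def)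
  have "\<theta> * c \<le> 1 * c" using \<theta> pos by (intro mult_right_mono) auto
  then show "\<kappa> \<le> c / 2" using pos by (simp add: \<kappa>_def)
qed

text \<open>Starting at distance \<open>exp (- \<tau>)\<close> and comparing at time \<open>T\<close> with \<open>\<tau> = c T / 2\<close>: the nonlinear
  trajectory has by then decayed to \<open>exp (- c T)\<close>, which is small even relative to \<open>exp (- \<tau>)\<close>, and
  its relative deviation from the linear flow is a power of \<open>exp (- \<tau>)\<close>. So any exponential rate
  \<open>a\<close> that bounds the linear flow can be lowered by an amount \<open>\<kappa>\<close> that does not depend on \<open>a\<close>.\<close>

lemma improve_rate_eventually:
  assumes C: "C \<ge> 0"
    and E: "\<And>t x. t \<ge> 0 \<Longrightarrow> norm (exp_flow A t x) \<le> C * exp (a * t) * norm x"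
  obtains C' where
    "eventually (\<lambda>T. norm (exp_flow A T (F' v)) \<le> C' * (exp (- (c / 2) * T) + exp ((a - \<kappa>) * T))) at_top"
proof -
  note linE = linear_exp_flow[OF linear_A]
  obtain C1 D \<tau>0 where C1: "C1 \<ge> 0" and D: "D \<ge> 0"
    and close: "\<And>p \<tau>. solution p \<Longrightarrow> norm (p 0 - z) \<le> norm v * exp (- \<tau>) \<Longrightarrow> \<tau> \<ge> \<tau>0 \<Longrightarrow>
      norm (F (p 0) - F z) \<le> C1 * exp (- \<tau>) \<and> p 0 \<in> ball z \<rho> \<and>
      (\<forall>t\<ge>0. p t \<in> ball z \<rho> \<and> norm (p t - z) \<le> D * exp (- \<theta> * \<tau>))"
    using stays_close[OF norm_ge_zero[of v]] by blast
  define C' where "C' = N + 2 * C\<^sup>2 * L * D * C1 / \<kappa> + C * L * (norm v)\<^sup>2"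
  have T_exp: "T * exp (- 2 * \<kappa> * T) \<le> exp (- \<kappa> * T) / \<kappa>" for T
  proof -
    have "\<kappa> * T \<le> exp (\<kappa> * T)" using exp_ge_add_one_self[of "\<kappa> * T"] by linarith
    then have "\<kappa> * T * exp (- 2 * \<kappa> * T) \<le> exp (\<kappa> * T) * exp (- 2 * \<kappa> * T)"
      by (rule mult_right_mono) simp
    then show ?thesis using \<kappa> by (simp add: field_simps flip: exp_add)
  qed
  have lim: "((\<lambda>T. k * exp (- r * T)) \<longlongrightarrow> 0) at_top" if "r > 0" for k r :: real
  proof -
    have "((\<lambda>T. k * exp (- r * T)) \<longlongrightarrow> k * 0) at_top"
      using that by (intro tendsto_mult tendsto_const filterlim_compose[OF exp_at_bot])
       (simp add: filterlim_uminus_at_bot filterlim_tendsto_pos_mult_at_top[OF tendsto_const]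
          filterlim_ident)
    then show ?thesis by simp
  qed
  have "eventually (\<lambda>T. (C * L * D / \<kappa>) * exp (- \<kappa> * T) < 1 / 2) at_top"
    using lim[OF \<kappa>(1)] by (rule order_tendstoD) simp
  moreover have "eventually (\<lambda>T. norm v * exp (- (c / 2) * T) < \<rho>) at_top"
    using lim[of "c / 2"] pos by (intro order_tendstoD) auto
  moreover have "eventually (\<lambda>T. T \<ge> max 0 (2 * \<tau>0 / c)) at_top"
    by (rule eventually_ge_at_top)
  ultimately have "eventually (\<lambda>T. norm (exp_flow A T (F' v))
      \<le> C' * (exp (- (c / 2) * T) + exp ((a - \<kappa>) * T))) at_top"
  proof eventually_elim
    case (elim T)
    define \<tau> where "\<tau> = c / 2 * T"
    define \<epsilon> where "\<epsilon> = L * D * exp (- 2 * \<kappa> * T)"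
    have T: "0 \<le> T" and \<tau>: "\<tau> \<ge> \<tau>0"
      using elim(3) pos by (auto simp: \<tau>_def field_simps)
    have \<theta>\<tau>: "- \<theta> * \<tau> = - 2 * \<kappa> * T" by (simp add: \<tau>_def \<kappa>_def)
    have "z + exp (- \<tau>) *\<^sub>R v \<in> ball z \<rho>"
      using elim(2) by (simp add: dist_norm \<tau>_def mult.commute)
    from trajectory[OF this] obtain p where p: "solution p" and p0: "p 0 = z + exp (- \<tau>) *\<^sub>R v"
      by (auto simp: solution_def)
    have "norm (p 0 - z) \<le> norm v * exp (- \<tau>)" by (simp add: p0 mult.commute)
    from close[OF p this \<tau>]
    have init: "norm (F (p 0) - F z) \<le> C1 * exp (- \<tau>)"
      and near: "\<And>t. t \<ge> 0 \<Longrightarrow> p t \<in> ball z \<rho>"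
        "\<And>t. t \<ge> 0 \<Longrightarrow> norm (p t - z) \<le> D * exp (- 2 * \<kappa> * T)"
      unfolding \<theta>\<tau> by blast+
    define x where "x t = F (p t) - F z" for t
    have \<epsilon>: "\<epsilon> \<ge> 0" using pos D by (simp add: \<epsilon>_def)
    have "T * C * \<epsilon> = C * L * D * (T * exp (- 2 * \<kappa> * T))" by (simp add: \<epsilon>_def)
    also have "\<dots> \<le> C * L * D * (exp (- \<kappa> * T) / \<kappa>)"
      using C pos D by (intro mult_left_mono T_exp) auto
    finally have T\<epsilon>: "T * C * \<epsilon> \<le> (C * L * D / \<kappa>) * exp (- \<kappa> * T)" by simp
    have "norm (x T - exp_flow A T (x 0)) \<le> 2 * T * C\<^sup>2 * \<epsilon> * exp (a * T) * norm (x 0)"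
    proof (rule exp_flow_perturbation[OF linear_A C E T _ _ \<epsilon>])
      show "(x has_vector_derivative X (p t)) (at t within {0..T})" if "0 \<le> t" "t \<le> T" for t
        using solution_within(2)[OF p that] by (simp add: x_def[abs_def])
      show "norm (X (p t) - A (x t)) \<le> \<epsilon> * norm (x t)" if "0 \<le> t" "t \<le> T" for t
      proof -
        have "norm (X (p t) - A (x t)) \<le> L * norm (p t - z) * norm (x t)"
          unfolding x_def using near(1) that by (intro X_diff) auto
        also have "\<dots> \<le> L * (D * exp (- 2 * \<kappa> * T)) * norm (x t)"
          using near(2) that pos by (intro mult_right_mono mult_left_mono) auto
        finally show ?thesis by (simp add: \<epsilon>_def)
      qed
      show "T * C * \<epsilon> \<le> 1 / 2" using T\<epsilon> elim(1) by linarith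
    qed simp
    also have "\<dots> = 2 * C * exp (a * T) * ((T * C * \<epsilon>) * norm (x 0))"
      by (simp add: power2_eq_square)
    also have "\<dots> \<le> 2 * C * exp (a * T) * (((C * L * D / \<kappa>) * exp (- \<kappa> * T)) * (C1 * exp (- \<tau>)))"
    proof (rule mult_left_mono[OF mult_mono[OF T\<epsilon>]])
      show "norm (x 0) \<le> C1 * exp (- \<tau>)" using init by (simp add: x_def)
    qed (use C pos D \<kappa>(1) in auto)
    also have "\<dots> = (2 * C\<^sup>2 * L * D * C1 / \<kappa>) * exp ((a - \<kappa>) * T) * exp (- \<tau>)"
      by (simp add: power2_eq_square algebra_simps flip: exp_add)
    finally have dev: "norm (x T - exp_flow A T (x 0))
        \<le> (2 * C\<^sup>2 * L * D * C1 / \<kappa>) * exp ((a - \<kappa>) * T) * exp (- \<tau>)" .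
    have xT: "norm (x T) \<le> N * exp (- (c / 2) * T) * exp (- \<tau>)"
    proof -
      have "norm (x T) \<le> N * exp (- c * T)"
        using p T by (simp add: solution_def x_def)
      also have "exp (- c * T) = exp (- (c / 2) * T) * exp (- \<tau>)"
        by (simp add: \<tau>_def flip: exp_add)
      finally show ?thesis by simp
    qed
    have quad: "norm (exp_flow A T (x 0 - exp (- \<tau>) *\<^sub>R F' v))
        \<le> C * L * (norm v)\<^sup>2 * exp ((a - \<kappa>) * T) * exp (- \<tau>)"
    proof -
      have "norm (x 0 - exp (- \<tau>) *\<^sub>R F' v) \<le> L * (norm (p 0 - z))\<^sup>2"
        using F_diff[OF near(1)[of 0]] by (simp add: x_def p0 linear_scale[OF linear_F'])
      also have "norm (p 0 - z) = norm v * exp (- \<tau>)" by (simp add: p0)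
      also have "L * (norm v * exp (- \<tau>))\<^sup>2 = L * (norm v)\<^sup>2 * exp (- \<tau>) * exp (- \<tau>)"
        by (simp add: power2_eq_square)
      finally have "C * exp (a * T) * norm (x 0 - exp (- \<tau>) *\<^sub>R F' v)
          \<le> C * exp (a * T) * (L * (norm v)\<^sup>2 * exp (- \<tau>) * exp (- \<tau>))"
        using C by (intro mult_left_mono) auto
      with E[OF T] have "norm (exp_flow A T (x 0 - exp (- \<tau>) *\<^sub>R F' v))
          \<le> C * exp (a * T) * (L * (norm v)\<^sup>2 * exp (- \<tau>) * exp (- \<tau>))"
        by (rule order_trans)
      also have "\<dots> = C * L * (norm v)\<^sup>2 * exp (a * T - \<tau>) * exp (- \<tau>)"
        by (simp add: exp_diff exp_minus field_simps)
      also have "\<dots> \<le> C * L * (norm v)\<^sup>2 * exp ((a - \<kappa>) * T) * exp (- \<tau>)"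
      proof -
        have "\<kappa> * T \<le> \<tau>" unfolding \<tau>_def using \<kappa> T by (intro mult_right_mono) auto
        then show ?thesis
          using C pos by (intro mult_left_mono mult_right_mono) (auto simp: algebra_simps)
      qed
      finally show ?thesis .
    qed
    have split: "exp_flow A T (exp (- \<tau>) *\<^sub>R F' v)
        = x T - (x T - exp_flow A T (x 0)) - exp_flow A T (x 0 - exp (- \<tau>) *\<^sub>R F' v)"
      by (simp add: linear_diff[OF linE])
    have "norm (exp_flow A T (exp (- \<tau>) *\<^sub>R F' v))
        \<le> norm (x T) + norm (x T - exp_flow A T (x 0))
          + norm (exp_flow A T (x 0 - exp (- \<tau>) *\<^sub>R F' v))"
      unfolding split
      using norm_triangle_ineq4[of "x T - (x T - exp_flow A T (x 0))"
          "exp_flow A T (x 0 - exp (- \<tau>) *\<^sub>R F' v)"]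
        norm_triangle_ineq4[of "x T" "x T - exp_flow A T (x 0)"] by linarith
    also have "\<dots> \<le> N * exp (- (c / 2) * T) * exp (- \<tau>)
        + (2 * C\<^sup>2 * L * D * C1 / \<kappa>) * exp ((a - \<kappa>) * T) * exp (- \<tau>)
        + C * L * (norm v)\<^sup>2 * exp ((a - \<kappa>) * T) * exp (- \<tau>)"
      by (intro add_mono xT dev quad)
    finally have "exp (- \<tau>) * norm (exp_flow A T (F' v)) \<le> exp (- \<tau>) *
       (N * exp (- (c / 2) * T) + (2 * C\<^sup>2 * L * D * C1 / \<kappa>) * exp ((a - \<kappa>) * T)
        + C * L * (norm v)\<^sup>2 * exp ((a - \<kappa>) * T))"
      by (simp add: linear_scale[OF linE] algebra_simps)
    then have "norm (exp_flow A T (F' v)) \<le> N * exp (- (c / 2) * T)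
        + (2 * C\<^sup>2 * L * D * C1 / \<kappa>) * exp ((a - \<kappa>) * T)
        + C * L * (norm v)\<^sup>2 * exp ((a - \<kappa>) * T)"
      by simp
    also have "\<dots> \<le> C' * exp (- (c / 2) * T) + C' * exp ((a - \<kappa>) * T)"
    proof -
      have "N \<le> C'" "2 * C\<^sup>2 * L * D * C1 / \<kappa> + C * L * (norm v)\<^sup>2 \<le> C'"
        using pos C D C1 \<kappa> by (auto simp: C'_def)
      then have "N * exp (- (c / 2) * T) \<le> C' * exp (- (c / 2) * T)"
        "(2 * C\<^sup>2 * L * D * C1 / \<kappa> + C * L * (norm v)\<^sup>2) * exp ((a - \<kappa>) * T) \<le> C' * exp ((a - \<kappa>) * T)"
        by (auto intro!: mult_right_mono)
      then show ?thesis unfolding distrib_right by linarith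
    qed
    finally show ?case by (simp add: distrib_left)
  qed
  then show thesis by (rule that)
qed

lemma improve_rate:
  assumes C: "C \<ge> 0"
    and E: "\<And>t x. t \<ge> 0 \<Longrightarrow> norm (exp_flow A t x) \<le> C * exp (a * t) * norm x"
    and b: "b \<ge> - (c / 2)" "b \<ge> a - \<kappa>"
  shows "\<exists>C'. \<forall>t\<ge>0. norm (exp_flow A t (F' v)) \<le> C' * exp (b * t)"
proof -
  obtain C' where
    "eventually (\<lambda>T. norm (exp_flow A T (F' v)) \<le> C' * (exp (- (c / 2) * T) + exp ((a - \<kappa>) * T))) at_top"
    using improve_rate_eventually[OF C E] by blast
  then obtain T0 where T0: "\<And>T. T \<ge> T0 \<Longrightarrow>
      norm (exp_flow A T (F' v)) \<le> C' * (exp (- (c / 2) * T) + exp ((a - \<kappa>) * T))"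
    by (auto simp: eventually_at_top_linorder)
  define C'' where "C'' = max (2 * \<bar>C'\<bar>) (C * exp (\<bar>a - b\<bar> * max T0 0) * norm (F' v))"
  have "norm (exp_flow A t (F' v)) \<le> C'' * exp (b * t)" if t: "t \<ge> 0" for t
  proof (cases "t \<ge> T0")
    case True
    have "norm (exp_flow A t (F' v)) \<le> C' * (exp (- (c / 2) * t) + exp ((a - \<kappa>) * t))"
      using T0[OF True] .
    also have "\<dots> \<le> \<bar>C'\<bar> * (exp (b * t) + exp (b * t))"
    proof (rule mult_mono)
      show "exp (- (c / 2) * t) + exp ((a - \<kappa>) * t) \<le> exp (b * t) + exp (b * t)"
        using mult_right_mono[OF b(1) t] mult_right_mono[OF b(2) t] by (intro add_mono) auto
    qed auto
    also have "\<dots> = (2 * \<bar>C'\<bar>) * exp (b * t)" by simp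
    also have "\<dots> \<le> C'' * exp (b * t)" by (intro mult_right_mono) (auto simp: C''_def)
    finally show ?thesis .
  next
    case False
    have "(a - b) * t \<le> \<bar>a - b\<bar> * max T0 0"
      using False t by (intro mult_mono) auto
    then have "exp (a * t) \<le> exp (\<bar>a - b\<bar> * max T0 0) * exp (b * t)"
      by (simp add: algebra_simps flip: exp_add)
    then have "C * exp (a * t) * norm (F' v)
        \<le> C * (exp (\<bar>a - b\<bar> * max T0 0) * exp (b * t)) * norm (F' v)"
      using C by (intro mult_right_mono mult_left_mono) auto
    also have "\<dots> = (C * exp (\<bar>a - b\<bar> * max T0 0) * norm (F' v)) * exp (b * t)" by simp
    also have "\<dots> \<le> C'' * exp (b * t)" by (intro mult_right_mono) (auto simp: C''_def)
    finally show ?thesis using E[OF t, of "F' v"] by linarith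
  qed
  then show ?thesis by blast
qed

definition flow_rate :: "real \<Rightarrow> bool" where
  "flow_rate a \<longleftrightarrow> (\<exists>C\<ge>0. \<forall>t\<ge>0. \<forall>x. norm (exp_flow A t x) \<le> C * exp (a * t) * norm x)"

lemma flow_rateI:
  assumes "C \<ge> 0" "\<And>t x. t \<ge> 0 \<Longrightarrow> norm (exp_flow A t x) \<le> C * exp (a * t) * norm x"
  shows "flow_rate a"
  unfolding flow_rate_def using assms by (intro exI[of _ C]) simp

lemma flow_rateE:
  assumes "flow_rate a"
  obtains C where "C \<ge> 0" "\<And>t x. t \<ge> 0 \<Longrightarrow> norm (exp_flow A t x) \<le> C * exp (a * t) * norm x"
proof -
  from assms obtain C
    where "C \<ge> 0 \<and> (\<forall>t\<ge>0. \<forall>x. norm (exp_flow A t x) \<le> C * exp (a * t) * norm x)"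
    unfolding flow_rate_def by (elim exE)
  then show thesis by (intro that[of C]) auto
qed

text \<open>Bootstrapping from the crude bound of the linear flow, the rate is lowered by \<open>\<kappa>\<close> repeatedly
  until it is negative.\<close>

lemma linear_flow_decays:
  assumes split: "\<And>x. \<exists>v y. x = F' v + y \<and> A y = - y"
  shows "((\<lambda>t. exp_flow A t x) \<longlongrightarrow> 0) at_top"
proof -
  define \<gamma> where "\<gamma> = min (c / 2) 1"
  have \<gamma>: "\<gamma> > 0" "\<gamma> \<le> c / 2" "\<gamma> \<le> 1" using pos by (auto simp: \<gamma>_def)
  have improve: "flow_rate (max (- \<gamma>) (a - \<kappa>))" if a: "flow_rate a" for a
  proof -
    let ?b = "max (- \<gamma>) (a - \<kappa>)"
    obtain C where C: "C \<ge> 0" "\<And>t x. t \<ge> 0 \<Longrightarrow> norm (exp_flow A t x) \<le> C * exp (a * t) * norm x"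
      using flow_rateE[OF a] by blast
    have b: "?b \<ge> - (c / 2)" "?b \<ge> a - \<kappa>" using \<gamma>(2) by auto
    have "\<exists>C'. \<forall>t\<ge>0. norm (exp_flow A t x) \<le> C' * exp (?b * t)" for x
    proof -
      obtain v y where x: "x = F' v + y" and y: "A y = - y" using split by blast
      obtain C' where C': "\<And>t. t \<ge> 0 \<Longrightarrow> norm (exp_flow A t (F' v)) \<le> C' * exp (?b * t)"
        using improve_rate[OF C b, of v] by blast
      have "norm (exp_flow A t x) \<le> (C' + norm y) * exp (?b * t)" if t: "t \<ge> 0" for t
      proof -
        have "norm (exp_flow A t x) \<le> norm (exp_flow A t (F' v)) + norm (exp_flow A t y)"
          by (simp add: x linear_add[OF linear_exp_flow[OF linear_A]] norm_triangle_ineq)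
        also have "norm (exp_flow A t y) = norm y * exp (- 1 * t)"
          by (simp add: exp_flow_eigenvector[OF linear_A y])
        also have "\<dots> \<le> norm y * exp (?b * t)"
        proof -
          have "- 1 * t \<le> ?b * t" using \<gamma>(3) t by (intro mult_right_mono) auto
          then show ?thesis by (intro mult_left_mono) auto
        qed
        finally show ?thesis using C'[OF t] by (simp add: algebra_simps)
      qed
      then show ?thesis by blast
    qed
    then have "\<forall>x. \<exists>C'. \<forall>t\<ge>0. norm (exp_flow A t x) \<le> C' * exp (?b * t)" by blast
    from choice[OF this]
    obtain C' where C': "\<And>x t. t \<ge> 0 \<Longrightarrow> norm (exp_flow A t x) \<le> C' x * exp (?b * t)"
      by blast
    define S where "S = (\<Sum>b\<in>Basis. \<bar>C' b\<bar>)"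
    have "norm (exp_flow A t x) \<le> S * exp (?b * t) * norm x" if t: "t \<ge> 0" for t x
    proof -
      have "exp_flow A t x = (\<Sum>b\<in>Basis. (x \<bullet> b) *\<^sub>R exp_flow A t b)"
        by (subst (1) euclidean_representation[of x, symmetric])
           (simp only: linear_sum[OF linear_exp_flow[OF linear_A]]
             linear_scale[OF linear_exp_flow[OF linear_A]])
      then have "norm (exp_flow A t x) \<le> (\<Sum>b\<in>Basis. norm ((x \<bullet> b) *\<^sub>R exp_flow A t b))"
        by (simp only: norm_sum)
      also have "\<dots> \<le> (\<Sum>b\<in>Basis. norm x * (\<bar>C' b\<bar> * exp (?b * t)))"
      proof (rule sum_mono)
        fix b :: 'b assume b: "b \<in> Basis"
        have "norm (exp_flow A t b) \<le> \<bar>C' b\<bar> * exp (?b * t)"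
          by (rule order_trans[OF C'[OF t] mult_right_mono[OF abs_ge_self exp_ge_zero]])
        then show "norm ((x \<bullet> b) *\<^sub>R exp_flow A t b) \<le> norm x * (\<bar>C' b\<bar> * exp (?b * t))"
          using Basis_le_norm[OF b, of x] by (auto intro!: mult_mono)
      qed
      also have "\<dots> = S * exp (?b * t) * norm x"
        by (simp add: S_def sum_distrib_left sum_distrib_right mult_ac)
      finally show ?thesis .
    qed
    moreover have "S \<ge> 0" by (simp add: S_def sum_nonneg)
    ultimately show ?thesis by (intro flow_rateI[of S])
  qed
  obtain C0 a0 where "C0 \<ge> 0" "\<And>t x. t \<ge> 0 \<Longrightarrow> norm (exp_flow A t x) \<le> C0 * exp (a0 * t) * norm x"
    using exp_flow_crude_bound[OF linear_A] by blast
  then have start: "flow_rate a0" by (rule flow_rateI)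
  have iter: "flow_rate (max (- \<gamma>) (a0 - real n * \<kappa>))" for n
  proof (induction n)
    case 0
    obtain C where C: "C \<ge> 0" "\<And>t x. t \<ge> 0 \<Longrightarrow> norm (exp_flow A t x) \<le> C * exp (a0 * t) * norm x"
      using flow_rateE[OF start] by blast
    have "norm (exp_flow A t x) \<le> C * exp (max (- \<gamma>) (a0 - real 0 * \<kappa>) * t) * norm x"
      if t: "t \<ge> 0" for t x
    proof -
      have "exp (a0 * t) \<le> exp (max (- \<gamma>) (a0 - real 0 * \<kappa>) * t)"
        using mult_right_mono[OF _ t, of a0 "max (- \<gamma>) a0"] by simp
      then have "C * exp (a0 * t) * norm x \<le> C * exp (max (- \<gamma>) (a0 - real 0 * \<kappa>) * t) * norm x"
        using C(1) by (intro mult_right_mono mult_left_mono) auto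
      with C(2)[OF t, of x] show ?thesis by linarith
    qed
    with C(1) show ?case by (rule flow_rateI)
  next
    case (Suc n)
    have "max (- \<gamma>) (max (- \<gamma>) (a0 - real n * \<kappa>) - \<kappa>) = max (- \<gamma>) (a0 - real (Suc n) * \<kappa>)"
      using \<kappa>(1) by (auto simp: max_def algebra_simps)
    with improve[OF Suc] show ?case by simp
  qed
  obtain n where "real n * \<kappa> > a0 + \<gamma>"
    using reals_Archimedean3[OF \<kappa>(1)] by blast
  then have "max (- \<gamma>) (a0 - real n * \<kappa>) = - \<gamma>" by simp
  with iter[of n] have final: "flow_rate (- \<gamma>)" by (simp only:)
  obtain C where "C \<ge> 0" and
    C: "\<And>t x. t \<ge> 0 \<Longrightarrow> norm (exp_flow A t x) \<le> C * exp (- \<gamma> * t) * norm x"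
    using flow_rateE[OF final] by blast
  have "((\<lambda>t. C * exp (- \<gamma> * t) * norm x) \<longlongrightarrow> C * 0 * norm x) at_top"
    using \<gamma> by (intro tendsto_mult tendsto_const filterlim_compose[OF exp_at_bot])
       (simp add: filterlim_uminus_at_bot filterlim_tendsto_pos_mult_at_top[OF tendsto_const]
          filterlim_ident)
  then have "((\<lambda>t. C * exp (- \<gamma> * t) * norm x) \<longlongrightarrow> 0) at_top" by simp
  moreover have "eventually (\<lambda>t. norm (exp_flow A t x) \<le> C * exp (- \<gamma> * t) * norm x) at_top"
    using eventually_ge_at_top[of 0] by (rule eventually_mono) (rule C)
  ultimately show ?thesis by (rule Lim_null_comparison[rotated])
qed

end


section \<open>Transversal projections depending on a bilinear parameter\<close>

lemma gram_bilinear_diff: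
  fixes \<beta> :: "'a::euclidean_space \<Rightarrow> 'a \<Rightarrow> real^'n"
  assumes "bounded_bilinear \<beta>"
  obtains L where "L \<ge> 0"
    "\<And>p y. p \<in> ball z 1 \<Longrightarrow> norm (gram (\<beta> p) y - gram (\<beta> z) y) \<le> L * norm (p - z) * norm y"
proof -
  interpret bounded_bilinear \<beta> by fact
  obtain B where B: "B > 0" "\<And>p q. norm (\<beta> p q) \<le> norm p * norm q * B"
    using pos_bounded by blast
  define L where "L = real DIM('a) * (B * (B * (2 * norm z + 1)))"
  have "norm (gram (\<beta> p) y - gram (\<beta> z) y) \<le> L * norm (p - z) * norm y" if p: "p \<in> ball z 1" for p y
  proof -
    have np: "norm p \<le> norm z + 1"
      using p norm_triangle_sub[of p z] by (simp add: dist_norm norm_minus_commute)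
    have "norm ((\<beta> p b \<bullet> y) *\<^sub>R \<beta> p b - (\<beta> z b \<bullet> y) *\<^sub>R \<beta> z b)
        \<le> B * (B * (2 * norm z + 1)) * norm (p - z) * norm y" if b: "b \<in> Basis" for b
    proof -
      have 1: "norm (\<beta> (p - z) b) \<le> B * norm (p - z)"
        using B(2)[of "p - z" b] b by (simp add: mult.commute)
      have "norm (\<beta> p b) + norm (\<beta> z b) \<le> B * norm p + B * norm z"
        using B(2)[of p b] B(2)[of z b] b by (simp add: mult.commute)
      also have "\<dots> \<le> B * (2 * norm z + 1)"
        using mult_left_mono[OF np, of B] B(1) by (simp add: algebra_simps)
      finally have 2: "norm (\<beta> p b) + norm (\<beta> z b) \<le> B * (2 * norm z + 1)" .
      have "(\<beta> p b \<bullet> y) *\<^sub>R \<beta> p b - (\<beta> z b \<bullet> y) *\<^sub>R \<beta> z b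
          = (\<beta> (p - z) b \<bullet> y) *\<^sub>R \<beta> p b + (\<beta> z b \<bullet> y) *\<^sub>R \<beta> (p - z) b"
        by (simp add: diff_left inner_diff_left scaleR_left_diff_distrib scaleR_right_diff_distrib)
      then have "norm ((\<beta> p b \<bullet> y) *\<^sub>R \<beta> p b - (\<beta> z b \<bullet> y) *\<^sub>R \<beta> z b)
          \<le> \<bar>\<beta> (p - z) b \<bullet> y\<bar> * norm (\<beta> p b) + \<bar>\<beta> z b \<bullet> y\<bar> * norm (\<beta> (p - z) b)"
        using norm_triangle_ineq[of "(\<beta> (p - z) b \<bullet> y) *\<^sub>R \<beta> p b" "(\<beta> z b \<bullet> y) *\<^sub>R \<beta> (p - z) b"]
        by simp
      also have "\<dots> \<le> (norm (\<beta> (p - z) b) * norm y) * norm (\<beta> p b)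
          + (norm (\<beta> z b) * norm y) * norm (\<beta> (p - z) b)"
        by (intro add_mono mult_right_mono Cauchy_Schwarz_ineq2) auto
      also have "\<dots> = norm (\<beta> (p - z) b) * norm y * (norm (\<beta> p b) + norm (\<beta> z b))"
        by (simp add: algebra_simps)
      also have "\<dots> \<le> (B * norm (p - z)) * norm y * (B * (2 * norm z + 1))"
        using 1 2 B(1) by (intro mult_mono mult_right_mono) auto
      finally show ?thesis by (simp add: mult_ac)
    qed
    then have "norm (\<Sum>b\<in>Basis. (\<beta> p b \<bullet> y) *\<^sub>R \<beta> p b - (\<beta> z b \<bullet> y) *\<^sub>R \<beta> z b)
        \<le> (\<Sum>b\<in>(Basis::'a set). B * (B * (2 * norm z + 1)) * norm (p - z) * norm y)"
      by (intro sum_norm_le)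
    then show ?thesis unfolding gram_def sum_subtractf[symmetric] by (simp add: L_def mult.assoc)
  qed
  moreover have "L \<ge> 0" using B(1) by (simp add: L_def)
  ultimately show thesis by (intro that[of L])
qed

lemma (in coord_complement) P_K: "P (K y) = gram f y"
  by (simp add: P_def Kinv_K)

text \<open>The ranges of \<open>\<beta> p\<close> for \<open>p\<close> near \<open>z\<close> are complements of the same coordinate space, hence
  graphs over the range of \<open>\<beta> z\<close>, with slope \<open>O(|p - z|)\<close>.\<close>

lemma range_projection_defect:
  fixes \<beta> :: "'a::euclidean_space \<Rightarrow> 'a \<Rightarrow> real^'n"
  assumes \<beta>: "bounded_bilinear \<beta>" and z: "coord_complement J (\<beta> z)"
    and near: "\<forall>p. inj (augmented_gram J (\<beta> p)) \<longrightarrow> coord_complement J (\<beta> p)"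
  shows "\<exists>L\<ge>0. \<forall>\<^sub>F p in nhds z. \<forall>v.
    norm (\<beta> p v - coord_complement.P J (\<beta> z) (\<beta> p v)) \<le> L * norm (p - z) * norm (\<beta> p v)"
proof -
  interpret Z: coord_complement J "\<beta> z" by fact
  obtain L1 where L1: "L1 \<ge> 0"
    "\<And>p y. p \<in> ball z 1 \<Longrightarrow> norm (gram (\<beta> p) y - gram (\<beta> z) y) \<le> L1 * norm (p - z) * norm y"
    using gram_bilinear_diff[OF \<beta>, of z] by blast
  obtain B where B: "B > 0" "\<And>x. norm (Z.Kinv x) \<le> B * norm x"
    using linear_bounded_pos[OF Z.linear_Kinv] by blast
  obtain C where C: "C > 0" "\<And>x. norm (Z.P x) \<le> C * norm x"
    using linear_bounded_pos[OF Z.linear_P] by blast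
  define r where "r = min 1 (1 / (2 * B * (L1 + 1)))"
  have r: "r > 0" using B L1 by (simp add: r_def)
  define L where "L = (1 + C) * (L1 * (2 * B))"
  have "norm (\<beta> p v - Z.P (\<beta> p v)) \<le> L * norm (p - z) * norm (\<beta> p v)"
    if p: "dist p z < r" for p v
  proof -
    let ?K = "augmented_gram J (\<beta> p)"
    have p1: "p \<in> ball z 1" using p by (simp add: r_def dist_commute)
    have small: "B * (L1 * norm (p - z)) \<le> 1 / 2"
    proof -
      have "B * (L1 * norm (p - z)) \<le> B * ((L1 + 1) * (1 / (2 * B * (L1 + 1))))"
        using p L1 B by (intro mult_left_mono mult_mono) (auto simp: r_def dist_norm)
      also have "\<dots> = (B * (L1 + 1)) / (2 * (B * (L1 + 1)))" by (simp add: mult.assoc)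
      also have "\<dots> = 1 / 2"
        using B(1) L1(1) by (subst nonzero_divide_mult_cancel_right) auto
      finally show ?thesis .
    qed
    have lower: "norm y \<le> 2 * B * norm (?K y)" for y
    proof -
      have "norm y \<le> B * norm (Z.K y)" using B(2)[of "Z.K y"] by (simp add: Z.Kinv_K)
      also have "Z.K y = ?K y - (gram (\<beta> p) y - gram (\<beta> z) y)"
        by (simp add: augmented_gram_def)
      also have "norm \<dots> \<le> norm (?K y) + norm (gram (\<beta> p) y - gram (\<beta> z) y)"
        by (rule norm_triangle_ineq4)
      also have "\<dots> \<le> norm (?K y) + L1 * norm (p - z) * norm y"
        using L1(2)[OF p1] by simp
      finally have "norm y \<le> B * norm (?K y) + B * (L1 * norm (p - z)) * norm y"
        using B(1) by (simp add: algebra_simps)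
      also have "\<dots> \<le> B * norm (?K y) + 1 / 2 * norm y"
        using small by (intro add_left_mono mult_right_mono) auto
      finally show ?thesis by simp
    qed
    have "y = 0" if "?K y = 0" for y
      using lower[of y] that by simp
    then have "inj ?K"
      unfolding linear_injective_0[OF linear_augmented_gram] by blast
    then interpret Q: coord_complement J "\<beta> p" by (rule near[rule_format])
    define y where "y = Q.Kinv (\<beta> p v)"
    have Ky: "?K y = \<beta> p v" by (simp add: y_def Q.K_Kinv)
    then have gy: "gram (\<beta> p) y = \<beta> p v" and Jy: "coord_proj J y = 0"
      by (rule Q.range_preimage)+
    define u where "u = gram (\<beta> z) y"
    have "Z.P u = u"
      using Z.P_K[of y] Z.K_split[of y] Jy by (simp add: u_def)
    then have "\<beta> p v - Z.P (\<beta> p v) = (\<beta> p v - u) - Z.P (\<beta> p v - u)"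
      by (simp add: linear_diff[OF Z.linear_P])
    also have "norm \<dots> \<le> norm (\<beta> p v - u) + norm (Z.P (\<beta> p v - u))"
      by (rule norm_triangle_ineq4)
    also have "\<dots> \<le> (1 + C) * norm (\<beta> p v - u)"
      using C(2)[of "\<beta> p v - u"] by (simp add: algebra_simps)
    also have "\<dots> \<le> (1 + C) * (L1 * norm (p - z) * norm y)"
      using L1(2)[OF p1, of y] C(1) by (intro mult_left_mono) (auto simp: u_def gy)
    also have "\<dots> \<le> (1 + C) * (L1 * norm (p - z) * (2 * B * norm (\<beta> p v)))"
      using lower[of y] C(1) L1(1) by (intro mult_left_mono) (auto simp: Ky)
    finally show ?thesis by (simp add: L_def algebra_simps)
  qed
  then have "\<forall>\<^sub>F p in nhds z. \<forall>v.
      norm (\<beta> p v - Z.P (\<beta> p v)) \<le> L * norm (p - z) * norm (\<beta> p v)"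
    using r unfolding eventually_nhds_metric by blast
  moreover have "L \<ge> 0" using B C L1 by (simp add: L_def)
  ultimately show ?thesis by blast
qed


section \<open>The squared-length map as a quadratic form\<close>

text \<open>The polar form of the distance map, equal to \<open>R(p) q\<close>. Each edge contributes the two orders of its
  end points to the double sum, hence the division by 2.\<close>

definition edge_pairing :: "'v::finite set set \<Rightarrow> real^'d^'v \<Rightarrow> real^'d^'v \<Rightarrow> real^('v set)" where
  "edge_pairing E p q =
     (\<chi> e. if e \<in> E then (\<Sum>i\<in>e. \<Sum>j\<in>e. (p $ j - p $ i) \<bullet> (q $ j - q $ i)) / 2 else 0)"

lemma edge_pairing_commute: "edge_pairing E p q = edge_pairing E q p"
  by (simp add: edge_pairing_def inner_commute cong: if_cong)

lemma bounded_bilinear_edge_pairing: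
  fixes E :: "'v::finite set set"
  shows "bounded_bilinear (edge_pairing E :: real^'d^'v \<Rightarrow> _)"
proof -
  have l: "linear (edge_pairing E p)" for p :: "real^'d^'v"
  proof (rule linearI)
    fix x y :: "real^'d^'v" and r :: real
    have "u \<bullet> ((x + y) $ j - (x + y) $ i) = u \<bullet> (x $ j - x $ i) + u \<bullet> (y $ j - y $ i)" for u i j
      by (simp add: inner_diff_right inner_add_right)
    then show "edge_pairing E p (x + y) = edge_pairing E p x + edge_pairing E p y"
      by (simp only: edge_pairing_def sum.distrib add_divide_distrib) (simp add: vec_eq_iff)
    have "u \<bullet> ((r *\<^sub>R x) $ j - (r *\<^sub>R x) $ i) = r * (u \<bullet> (x $ j - x $ i))" for u i j
      by (simp add: inner_diff_right right_diff_distrib)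
    then show "edge_pairing E p (r *\<^sub>R x) = r *\<^sub>R edge_pairing E p x"
      by (simp only: edge_pairing_def sum_distrib_left[symmetric]) (simp add: vec_eq_iff)
  qed
  moreover have "linear (\<lambda>p. edge_pairing E p q)" for q :: "real^'d^'v"
    using l[of q] unfolding edge_pairing_commute[of E _ q] .
  ultimately have "bilinear (edge_pairing E :: real^'d^'v \<Rightarrow> _)"
    unfolding bilinear_def by blast
  then show ?thesis by (simp add: bilinear_conv_bounded_bilinear)
qed

lemmas edge_pairing_bilinear =
  bounded_bilinear.add_left[OF bounded_bilinear_edge_pairing]
  bounded_bilinear.add_right[OF bounded_bilinear_edge_pairing]
  bounded_bilinear.diff_left[OF bounded_bilinear_edge_pairing]
  bounded_bilinear.diff_right[OF bounded_bilinear_edge_pairing]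
  bounded_bilinear.scaleR_left[OF bounded_bilinear_edge_pairing]
  bounded_bilinear.scaleR_right[OF bounded_bilinear_edge_pairing]

lemma linear_edge_pairing: "linear (edge_pairing E p)"
  by (rule linearI) (simp_all add: edge_pairing_bilinear)

lemma edge_pairing_in_edge_space: "edge_pairing E p q \<in> edge_space E"
  by (simp add: edge_pairing_def edge_space_def)

lemma distance_map_eq_edge_pairing:
  assumes "simple_graph E"
  shows "distance_map E p = edge_pairing E p p"
proof -
  have "distance_map E p $ e = edge_pairing E p p $ e" for e
  proof (cases "e \<in> E")
    case True
    then have "card e = 2" using assms by (simp add: simple_graph_def)
    then obtain i j where e: "e = {i, j}" "i \<noteq> j" by (meson card_2_iff)
    have "(p $ i - p $ j) \<bullet> (p $ i - p $ j) = (p $ j - p $ i) \<bullet> (p $ j - p $ i)"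
      by (simp add: inner_diff_left inner_diff_right)
    then show ?thesis
      using True distance_map_edge[of i j E p] e by (simp add: edge_pairing_def dot_square_norm)
  qed (simp add: distance_map_def edge_pairing_def)
  then show ?thesis by (simp add: vec_eq_iff)
qed

text \<open>A difference of values is a tangent vector at the midpoint, without an error term.\<close>

lemma distance_map_diff:
  assumes "simple_graph E"
  shows "distance_map E p - distance_map E q = edge_pairing E (p + q) (p - q)"
  by (simp add: distance_map_eq_edge_pairing[OF assms] edge_pairing_bilinear
      edge_pairing_commute[of E p q])

lemma congruent_distance_map:
  assumes "simple_graph E" "congruent_config p q"
  shows "distance_map E p = distance_map E q"
proof -
  obtain T where "\<And>x y. dist (T x) (T y) = dist x y" "\<And>i. q $ i = T (p $ i)"
    using assms(2) unfolding congruent_config_def by blast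
  then have "norm (q $ j - q $ i) = norm (p $ j - p $ i)" for i j
    by (metis dist_norm)
  then have eq: "(q $ j - q $ i) \<bullet> (q $ j - q $ i) = (p $ j - p $ i) \<bullet> (p $ j - p $ i)" for i j
    by (simp add: dot_square_norm)
  show ?thesis
    unfolding distance_map_eq_edge_pairing[OF assms(1)] edge_pairing_def eq ..
qed

lemma distance_map_has_derivative:
  assumes "simple_graph E"
  shows "(distance_map E has_derivative (\<lambda>v. 2 *\<^sub>R edge_pairing E p v)) (at p)"
proof -
  have "((\<lambda>p. edge_pairing E p p) has_derivative (\<lambda>v. edge_pairing E p v + edge_pairing E v p)) (at p)"
    by (rule bounded_bilinear.FDERIV[OF bounded_bilinear_edge_pairing]) (rule has_derivative_ident)+
  moreover have "edge_pairing E p v + edge_pairing E v p = 2 *\<^sub>R edge_pairing E p v" for v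
    unfolding scaleR_2 edge_pairing_commute[of E v p] ..
  ultimately show ?thesis
    unfolding distance_map_eq_edge_pairing[OF assms, abs_def] by simp
qed

text \<open>Hyperbolicity passes to smaller subspaces, so that an inclusion is enough; it follows from
  the monotonicity of \<open>tangent_space\<close> in the set.\<close>

lemma tangent_space_regular_values_subset:
  fixes p :: "real^'d::finite^'v::finite"
  assumes E: "simple_graph E" and p: "p \<in> regular_configs E"
  shows "tangent_space (regular_values TYPE('d) E) (distance_map E p) \<subseteq> range (edge_pairing E p)"
proof -
  let ?F = "distance_map E :: real^'d^'v \<Rightarrow> _"
  have "regular_values TYPE('d) E \<subseteq> range ?F"
    by (auto simp: regular_values_def regular_value_def Let_def)
  then have "tangent_space (regular_values TYPE('d) E) (?F p) \<subseteq> tangent_space (range ?F) (?F p)"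
    unfolding tangent_space_def by blast
  also have "tangent_space (range ?F) (?F p) = range (frechet_derivative ?F (at p))"
    using p by (auto simp: regular_configs_def regular_values_def regular_value_def Let_def)
  also have "frechet_derivative ?F (at p) = (\<lambda>v. edge_pairing E p (2 *\<^sub>R v))"
    using frechet_derivative_at[OF distance_map_has_derivative[OF E, of p]]
    by (simp add: edge_pairing_bilinear)
  finally show ?thesis by auto
qed

lemma rat_polynomial_function_coord: "rat_polynomial_function (\<lambda>p::real^'d^'v. p $ i $ k)"
proof -
  have "axis i (axis k 1) \<in> (Basis :: (real^'d^'v) set)"
    by (simp add: axis_in_Basis_iff)
  from rat_polynomial_function.coord[OF this] show ?thesis by (simp add: inner_axis)
qed

lemma rat_polynomial_function_edge_pairing:
  assumes "\<And>i k. rat_polynomial_function (\<lambda>p. f p $ i $ k)" "\<And>i k. rat_polynomial_function (\<lambda>p. g p $ i $ k)"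
  shows "rat_polynomial_function (\<lambda>p. edge_pairing E (f p) (g p) $ e)"
proof (cases "e \<in> E")
  case True
  have "rat_polynomial_function (\<lambda>p. (1 / 2) *
      (\<Sum>i\<in>e. \<Sum>j\<in>e. \<Sum>k\<in>UNIV. (f p $ j $ k - f p $ i $ k) * (g p $ j $ k - g p $ i $ k)))"
    by (intro rat_polynomial_function_sum rat_polynomial_function.mult
          rat_polynomial_function_diff assms rat_polynomial_function.const) auto
  then show ?thesis using True by (simp add: edge_pairing_def inner_vec_def)
qed (simp add: edge_pairing_def rat_polynomial_function.const)

lemma rat_polynomial_function_on_graph:
  assumes E: "simple_graph E" and f: "rat_polynomial_function f"
  shows "rat_polynomial_function (\<lambda>p::real^'d^'v. f (p, distance_map E p))"
proof (rule rat_polynomial_function_compose[OF f])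
  fix b :: "(real^'d^'v) \<times> (real^('v set))"
  assume "b \<in> Basis"
  then consider c where "b = (c, 0)" "c \<in> Basis" | e where "b = (0, axis e 1)"
    by (auto simp: Basis_prod_def Basis_vec_def)
  then show "rat_polynomial_function (\<lambda>p. (p, distance_map E p) \<bullet> b)"
  proof cases
    case 1
    then show ?thesis by (simp add: rat_polynomial_function.coord)
  next
    case 2
    then show ?thesis
      by (simp add: inner_axis distance_map_eq_edge_pairing[OF E]
          rat_polynomial_function_edge_pairing rat_polynomial_function_coord)
  qed
qed

lemma rat_polynomial_function_gram:
  "rat_polynomial_function (\<lambda>p::real^'d^'v. gram (edge_pairing E p) (axis j 1) $ i)"
proof -
  have b: "rat_polynomial_function (\<lambda>p::real^'d^'v. b $ i $ k)"
    if "b \<in> Basis" for b :: "real^'d^'v" and i k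
    using that by (intro rat_polynomial_function.const) (auto simp: Basis_vec_def axis_def)
  have "rat_polynomial_function (\<lambda>p::real^'d^'v.
      \<Sum>b\<in>Basis. edge_pairing E p b $ j * edge_pairing E p b $ i)"
    by (intro rat_polynomial_function_sum rat_polynomial_function.mult
          rat_polynomial_function_edge_pairing rat_polynomial_function_coord b)
  then show ?thesis by (simp add: gram_def inner_axis)
qed


section \<open>Linear extension of the operators of a controller\<close>

text \<open>Operators on \<open>edge_space E\<close>, extended by zero on the other coordinates so that they become
  linear maps between Euclidean spaces.\<close>

definition zero_extension :: "'v::finite set set \<Rightarrow> (real^('v set) \<Rightarrow> 'b::real_vector) \<Rightarrow> real^('v set) \<Rightarrow> 'b" where
  "zero_extension E f x = (\<Sum>e\<in>E. x $ e *\<^sub>R f (axis e 1))"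

lemma linear_zero_extension: "linear (zero_extension E f)"
  by (rule linearI) (simp_all add: zero_extension_def scaleR_left_distrib sum.distrib scaleR_sum_right)

lemma zero_extension_eq:
  assumes f: "linear_map_on (edge_space E) f" and x: "x \<in> edge_space E"
  shows "zero_extension E f x = f x"
proof -
  have add: "f (a *\<^sub>R x + b *\<^sub>R y) = a *\<^sub>R f x + b *\<^sub>R f y"
    if "x \<in> edge_space E" "y \<in> edge_space E" for x y a b
    using f that unfolding linear_map_on_def by blast
  have zero: "(0 :: real^('a set)) \<in> edge_space E" by (simp add: edge_space_def)
  have partial: "f (\<Sum>e\<in>I. x $ e *\<^sub>R axis e 1) = (\<Sum>e\<in>I. x $ e *\<^sub>R f (axis e 1))
      \<and> (\<Sum>e\<in>I. x $ e *\<^sub>R axis e 1) \<in> edge_space E" if "I \<subseteq> E" for I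
    using finite[of I] that
  proof (induction I rule: finite_induct)
    case empty
    show ?case using add[OF zero zero, of 0 0] zero by simp
  next
    case (insert e I)
    then have IH: "f (\<Sum>e\<in>I. x $ e *\<^sub>R axis e 1) = (\<Sum>e\<in>I. x $ e *\<^sub>R f (axis e 1))"
      "(\<Sum>e\<in>I. x $ e *\<^sub>R axis e 1) \<in> edge_space E" by auto
    have e: "axis e 1 \<in> edge_space E"
      using insert.prems by (auto simp: edge_space_def axis_def)
    have "f (x $ e *\<^sub>R axis e 1 + 1 *\<^sub>R (\<Sum>e\<in>I. x $ e *\<^sub>R axis e 1))
        = x $ e *\<^sub>R f (axis e 1) + 1 *\<^sub>R (\<Sum>e\<in>I. x $ e *\<^sub>R f (axis e 1))"
      using add[OF e IH(2), of "x $ e" 1] IH(1) by simp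
    moreover have "x $ e *\<^sub>R axis e 1 + (\<Sum>e\<in>I. x $ e *\<^sub>R axis e 1) \<in> edge_space E"
      using e IH(2) by (simp add: edge_space_def)
    ultimately show ?case using insert.hyps by simp
  qed
  have "x = (\<Sum>e\<in>UNIV. x $ e *\<^sub>R axis e 1)"
    by (simp add: basis_expansion scalar_mult_eq_scaleR[symmetric])
  also have "\<dots> = (\<Sum>e\<in>E. x $ e *\<^sub>R axis e 1)"
    by (rule sum.mono_neutral_right) (use x in \<open>auto simp: edge_space_def\<close>)
  finally show ?thesis using partial[of E] by (simp add: zero_extension_def)
qed

lemma distance_map_in_edge_space: "distance_map E p \<in> edge_space E"
  by (simp add: distance_map_def edge_space_def)

text \<open>The comparison point \<open>s\<close> is fixed, so the bound comes from the derivative at \<open>s\<close> of a local extension.\<close>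

lemma smooth_on_subset_lipschitz_at:
  assumes "smooth_on_subset S g" "s \<in> S"
  shows "\<exists>L\<ge>0. \<forall>\<^sub>F s' in nhds s. s' \<in> S \<longrightarrow> norm (g s' - g s) \<le> L * norm (s' - s)"
proof -
  from bspec[OF assms(1)[unfolded smooth_on_subset_def] assms(2)]
  obtain U h where U: "s \<in> U" and h: "smooth_on U h" and hg: "\<forall>x\<in>S \<inter> U. h x = g x"
    by (elim exE conjE)
  have "open U" using h by (simp add: smooth_on_def)
  have "Ck_on (Suc 0) U h" using h by (simp only: smooth_on_def)
  then have "h differentiable (at s)" using U by (simp only: Ck_on.simps)
  then obtain h' where h': "(h has_derivative h') (at s)" unfolding differentiable_def by blast
  obtain B where B: "B > 0" "\<And>x. norm (h' x) \<le> B * norm x"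
    using linear_bounded_pos[OF has_derivative_linear[OF h']] by blast
  have "\<exists>d>0. \<forall>y. norm (y - s) < d \<longrightarrow> norm (h y - h s - h' (y - s)) \<le> 1 * norm (y - s)"
    by (rule conjunct2[OF h'[unfolded has_derivative_at_alt], rule_format, OF zero_less_one])
  then obtain d where d: "d > 0"
    "\<And>y. norm (y - s) < d \<Longrightarrow> norm (h y - h s - h' (y - s)) \<le> 1 * norm (y - s)"
    by blast
  have "\<forall>\<^sub>F s' in nhds s. s' \<in> U" using \<open>open U\<close> U by (rule eventually_nhds_in_open)
  moreover have "\<forall>\<^sub>F s' in nhds s. norm (s' - s) < d"
    unfolding eventually_nhds_metric using d(1) by (auto simp: dist_norm)
  ultimately have "\<forall>\<^sub>F s' in nhds s. s' \<in> S \<longrightarrow> norm (g s' - g s) \<le> (1 + B) * norm (s' - s)"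
  proof eventually_elim
    case (elim s')
    have "norm (h s' - h s) \<le> norm (h s' - h s - h' (s' - s)) + norm (h' (s' - s))"
      using norm_triangle_sub[of "h s' - h s" "h' (s' - s)"] by simp
    also have "\<dots> \<le> 1 * norm (s' - s) + B * norm (s' - s)"
      by (intro add_mono d B elim)
    finally have "norm (h s' - h s) \<le> (1 + B) * norm (s' - s)" by (simp add: algebra_simps)
    then show ?case using hg elim(1) U assms(2) by auto
  qed
  then show ?thesis using B(1) by (intro exI[of _ "1 + B"]) simp
qed

lemma state_space_iff: "(p, distance_map E p) \<in> state_space E \<longleftrightarrow> p \<in> regular_configs E"
  by (auto simp: state_space_def regular_configs_def)

lemma distance_map_locally_lipschitz:
  fixes E :: "'v::finite set set"
  assumes E: "simple_graph E"
  obtains C where "C > 0"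
    "\<And>p q :: real^'d^'v. norm (distance_map E p - distance_map E q) \<le> C * norm (p + q) * norm (p - q)"
proof -
  obtain C where C: "C > 0" "\<And>p q::real^'d^'v. norm (edge_pairing E p q) \<le> norm p * norm q * C"
    using bounded_bilinear.pos_bounded[OF bounded_bilinear_edge_pairing[of E]] by blast
  show thesis
  proof (rule that[OF C(1)])
    fix p q :: "real^'d^'v"
    show "norm (distance_map E p - distance_map E q) \<le> C * norm (p + q) * norm (p - q)"
      using C(2)[of "p + q" "p - q"] by (simp add: distance_map_diff[OF E] mult_ac)
  qed
qed

lemma controller_lipschitz_at:
  fixes z :: "real^'d::finite^'v::finite"
    and f :: "(real^'d^'v) \<times> (real^('v set)) \<Rightarrow> real^('v set) \<Rightarrow> 'b::euclidean_space"
  assumes E: "simple_graph E"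
    and f: "\<forall>x\<in>edge_space E. smooth_on_subset (state_space E) (\<lambda>s. f s x)"
    and z: "z \<in> regular_configs E"
  shows "\<exists>L\<ge>0. \<forall>\<^sub>F p in nhds z. p \<in> regular_configs E \<longrightarrow>
    (\<forall>x. norm (zero_extension E (f (p, distance_map E p)) x
      - zero_extension E (f (z, distance_map E z)) x) \<le> L * norm (p - z) * norm x)"
proof -
  let ?F = "distance_map E :: real^'d^'v \<Rightarrow> _"
  let ?G = "\<lambda>p. (p, ?F p)"
  obtain C where C: "C > 0" "\<And>p q. norm (?F p - ?F q) \<le> C * norm (p + q) * norm (p - q)"
    using distance_map_locally_lipschitz[OF E] by blast
  have cont: "(?G \<longlongrightarrow> ?G z) (nhds z)"
  proof -
    have "isCont ?F z" using distance_map_has_derivative[OF E, of z] by (rule has_derivative_continuous)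
    then have "isCont ?G z" by (intro continuous_intros)
    then show ?thesis unfolding isCont_def tendsto_at_iff_tendsto_nhds[of ?G z] .
  qed
  have one: "\<exists>L. L \<ge> 0 \<and> (\<forall>\<^sub>F p in nhds z. p \<in> regular_configs E \<longrightarrow>
      norm (f (?G p) (axis e 1) - f (?G z) (axis e 1)) \<le> L * norm (p - z))" if e: "e \<in> E" for e
  proof -
    have "axis e 1 \<in> edge_space E" using e by (auto simp: edge_space_def axis_def)
    from smooth_on_subset_lipschitz_at[OF bspec[OF f this], of "?G z"] z
    obtain L where L: "L \<ge> 0" "\<forall>\<^sub>F s in nhds (?G z). s \<in> state_space E \<longrightarrow>
        norm (f s (axis e 1) - f (?G z) (axis e 1)) \<le> L * norm (s - ?G z)"
      using state_space_iff[of z E] by blast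
    let ?M = "1 + C * (2 * norm z + 1)"
    have near: "\<forall>\<^sub>F p in nhds z. norm (p - z) < 1"
      unfolding eventually_nhds_metric by (auto simp: dist_norm intro!: exI[of _ 1])
    have "\<forall>\<^sub>F p in nhds z. ?G p \<in> state_space E \<longrightarrow>
        norm (f (?G p) (axis e 1) - f (?G z) (axis e 1)) \<le> L * norm (?G p - ?G z)"
      using eventually_compose_filterlim[OF L(2) cont] .
    with near have "\<forall>\<^sub>F p in nhds z. p \<in> regular_configs E \<longrightarrow>
        norm (f (?G p) (axis e 1) - f (?G z) (axis e 1)) \<le> (L * ?M) * norm (p - z)"
    proof eventually_elim
      case (elim p)
      show ?case
      proof
        assume "p \<in> regular_configs E"
        then have "norm (f (?G p) (axis e 1) - f (?G z) (axis e 1)) \<le> L * norm (?G p - ?G z)"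
          using elim(2) state_space_iff[of p E] by blast
        moreover have "norm (?G p - ?G z) \<le> ?M * norm (p - z)"
        proof -
          have "norm (p + z) \<le> 2 * norm z + 1"
            using norm_triangle_ineq[of "p - z" "z + z"] norm_triangle_ineq[of z z] elim(1)
              add.commute[of z p] by simp
          then have "C * norm (p + z) * norm (p - z) \<le> C * (2 * norm z + 1) * norm (p - z)"
            using C(1) by (intro mult_right_mono mult_left_mono) auto
          with C(2)[of p z] have "norm (?F p - ?F z) \<le> C * (2 * norm z + 1) * norm (p - z)"
            by (rule order_trans)
          moreover have "norm (?G p - ?G z) \<le> norm (p - z) + norm (?F p - ?F z)"
            by (simp add: norm_Pair_le)
          ultimately show ?thesis by (simp add: algebra_simps)
        qed
        then have "L * norm (?G p - ?G z) \<le> L * (?M * norm (p - z))"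
          using L(1) by (rule mult_left_mono)
        ultimately show "norm (f (?G p) (axis e 1) - f (?G z) (axis e 1)) \<le> (L * ?M) * norm (p - z)"
          unfolding mult.assoc by (rule order_trans)
      qed
    qed
    moreover have "L * ?M \<ge> 0" using L(1) C(1) by simp
    ultimately show ?thesis by blast
  qed
  then have "\<forall>e\<in>E. \<exists>L. L \<ge> 0 \<and> (\<forall>\<^sub>F p in nhds z. p \<in> regular_configs E \<longrightarrow>
      norm (f (?G p) (axis e 1) - f (?G z) (axis e 1)) \<le> L * norm (p - z))" by blast
  from bchoice[OF this] obtain L where L: "\<And>e. e \<in> E \<Longrightarrow> L e \<ge> 0"
    "\<And>e. e \<in> E \<Longrightarrow> \<forall>\<^sub>F p in nhds z. p \<in> regular_configs E \<longrightarrow>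
      norm (f (?G p) (axis e 1) - f (?G z) (axis e 1)) \<le> L e * norm (p - z)"
    by blast
  have "\<forall>\<^sub>F p in nhds z. \<forall>e\<in>E. p \<in> regular_configs E \<longrightarrow>
      norm (f (?G p) (axis e 1) - f (?G z) (axis e 1)) \<le> L e * norm (p - z)"
    using L(2) by (intro eventually_ball_finite) auto
  then have "\<forall>\<^sub>F p in nhds z. p \<in> regular_configs E \<longrightarrow>
      (\<forall>x. norm (zero_extension E (f (?G p)) x - zero_extension E (f (?G z)) x)
        \<le> (\<Sum>e\<in>E. L e) * norm (p - z) * norm x)"
  proof eventually_elim
    case (elim p)
    show ?case
    proof (intro impI allI)
      fix x assume p: "p \<in> regular_configs E"
      have "norm (\<Sum>e\<in>E. x $ e *\<^sub>R (f (?G p) (axis e 1) - f (?G z) (axis e 1)))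
          \<le> (\<Sum>e\<in>E. norm x * (L e * norm (p - z)))"
      proof (rule sum_norm_le)
        fix e assume "e \<in> E"
        then have "norm (f (?G p) (axis e 1) - f (?G z) (axis e 1)) \<le> L e * norm (p - z)"
          using elim p by blast
        then show "norm (x $ e *\<^sub>R (f (?G p) (axis e 1) - f (?G z) (axis e 1)))
            \<le> norm x * (L e * norm (p - z))"
          unfolding norm_scaleR using component_le_norm_cart[of x e]
          by (intro mult_mono) auto
      qed
      moreover have "zero_extension E (f (?G p)) x - zero_extension E (f (?G z)) x
          = (\<Sum>e\<in>E. x $ e *\<^sub>R (f (?G p) (axis e 1) - f (?G z) (axis e 1)))"
        by (simp add: zero_extension_def sum_subtractf scaleR_right_diff_distrib)
      ultimately show "norm (zero_extension E (f (?G p)) x - zero_extension E (f (?G z)) x)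
          \<le> (\<Sum>e\<in>E. L e) * norm (p - z) * norm x"
        by (simp add: sum_distrib_left[symmetric] sum_distrib_right[symmetric] mult_ac)
    qed
  qed
  moreover have "(\<Sum>e\<in>E. L e) \<ge> 0" using L(1) by (rule sum_nonneg)
  ultimately show ?thesis by blast
qed


section \<open>Stability at a target contracts the tangent space\<close>

text \<open>A set \<open>J\<close> of least cardinality for which \<open>augmented_gram\<close> is injective for some parameter is minimal
  for every parameter for which it is injective.\<close>

lemma obtain_generic_complement:
  fixes \<beta> :: "'a::euclidean_space \<Rightarrow> 'a \<Rightarrow> real^'n"
  assumes \<beta>: "\<And>p. linear (\<beta> p)"
  obtains J p0 where "inj (augmented_gram J (\<beta> p0))"
    and "\<forall>p. inj (augmented_gram J (\<beta> p)) \<longrightarrow> coord_complement J (\<beta> p)"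
proof -
  let ?Q = "\<lambda>J. \<exists>p. inj (augmented_gram J (\<beta> p))"
  have "inj (augmented_gram UNIV (\<beta> 0))"
    unfolding linear_injective_0[OF linear_augmented_gram] augmented_gram_eq_0_iff[OF \<beta>]
    by (simp add: vec_eq_iff)
  then have "?Q UNIV" by blast
  then have "\<exists>J. ?Q J \<and> (\<forall>J'. ?Q J' \<longrightarrow> card J \<le> card J')"
    by (rule ex_has_least_nat)
  then obtain J p0 where J: "inj (augmented_gram J (\<beta> p0))"
    and least: "\<And>J'. ?Q J' \<Longrightarrow> card J \<le> card J'" by blast
  show thesis
  proof (rule that[OF J], intro allI impI)
    fix p assume p: "inj (augmented_gram J (\<beta> p))"
    have min: "card J \<le> card J'" if "inj (augmented_gram J' (\<beta> p))" for J'
      using least that by blast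
    show "coord_complement J (\<beta> p)"
      by (rule coord_complement.intro[OF \<beta> p])
         (rule range_meets_coord_space_trivially[OF \<beta> p min])
  qed
qed

text \<open>For \<open>f = R(z)\<close> and \<open>H = \<eta>\<close> at the target \<open>z\<close>, this is \<open>- \<eta>\<close>, the linearization of the error dynamics, on
  the range of \<open>f\<close>; on the coordinate complement it is \<open>- 1\<close>.\<close>

definition target_linearization ::
  "'n::finite set \<Rightarrow> ('a::euclidean_space \<Rightarrow> real^'n) \<Rightarrow> (real^'n \<Rightarrow> real^'n) \<Rightarrow> real^'n \<Rightarrow> real^'n" where
  "target_linearization J f H x =
     - H (coord_complement.P J f x) - (x - coord_complement.P J f x)"

context coord_complement
begin

lemma linear_target_linearization:
  assumes "linear H"
  shows "linear (target_linearization J f H)"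
  unfolding target_linearization_def
  using linear_compose[OF linear_P assms] linear_P
  by (intro linear_compose_sub linear_compose_neg) (simp_all add: o_def linear_id[unfolded id_def])

lemma target_linearization_K:
  "target_linearization J f H (K y) = - H (gram f y) - coord_proj J y"
  unfolding target_linearization_def P_K by (simp add: K_split)

lemma target_linearization_decompose:
  assumes "linear H"
  shows "\<exists>v y. x = f v + y \<and> target_linearization J f H y = - y"
proof -
  obtain v y where "x = f v + coord_proj J y" using decompose by blast
  moreover have "target_linearization J f H (coord_proj J y) = - coord_proj J y"
    by (simp add: target_linearization_def P_coord_proj linear_0[OF assms])
  ultimately show ?thesis by blast
qed

end

text \<open>The limits \<open>q\<close> of the trajectories disappear from the statement, since \<open>F q = F z\<close>. The decay of the
  error needs a bound on \<open>q\<close>, which comes from \<open>|p 0 - q| \<le> N\<close>.\<close>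

lemma stable_target_trajectory:
  fixes z :: "real^'d::finite^'v::finite"
  assumes E: "simple_graph E" and compat: "compatible_controller E \<nu> \<eta>"
    and stable: "locally_exponentially_stable E \<nu> \<eta> z"
  shows "\<exists>U N c. open U \<and> z \<in> U \<and> U \<subseteq> regular_configs E \<and> N > 0 \<and> c > 0 \<and>
    (\<forall>p0\<in>U \<inter> ball z 1. \<exists>p. p 0 = p0 \<and> (\<forall>t\<ge>0.
      (p has_vector_derivative
        zero_extension E (\<nu> (p t, distance_map E (p t))) (distance_map E z - distance_map E (p t)))
        (at t within {0..}) \<and>
      ((\<lambda>t. distance_map E (p t)) has_vector_derivative
        zero_extension E (\<eta> (p t, distance_map E (p t))) (distance_map E z - distance_map E (p t)))
        (at t within {0..}) \<and>
      norm (distance_map E (p t) - distance_map E z) \<le> N * exp (- c * t)))"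
proof -
  let ?F = "distance_map E :: real^'d^'v \<Rightarrow> _"
  obtain U N c where U: "open U" "z \<in> U" "U \<subseteq> regular_configs E" and N: "N > 0" and c: "c > 0"
    and traj: "\<forall>p0\<in>U. \<exists>p m q. closed_loop_solution E \<nu> \<eta> (?F z) p m \<and>
           p 0 = p0 \<and> m 0 = ?F p0 \<and> q \<in> U \<and> congruent_config q z \<and>
           (\<forall>t\<ge>0. norm (p t - q) \<le> N * exp (- c * t))"
    using stable unfolding locally_exponentially_stable_def by (elim exE conjE)
  obtain C where C: "C > 0" "\<And>p q. norm (?F p - ?F q) \<le> C * norm (p + q) * norm (p - q)"
    using distance_map_locally_lipschitz[OF E] by blast
  define N' where "N' = C * (N + 2 * (N + (norm z + 1))) * N"
  have N': "N' > 0"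
    unfolding N'_def using C(1) N by (intro mult_pos_pos add_pos_nonneg) auto
  have "\<exists>p. p 0 = p0 \<and> (\<forall>t\<ge>0.
      (p has_vector_derivative zero_extension E (\<nu> (p t, ?F (p t))) (?F z - ?F (p t))) (at t within {0..}) \<and>
      ((\<lambda>t. ?F (p t)) has_vector_derivative zero_extension E (\<eta> (p t, ?F (p t))) (?F z - ?F (p t)))
        (at t within {0..}) \<and>
      norm (?F (p t) - ?F z) \<le> N' * exp (- c * t))" if p0: "p0 \<in> U \<inter> ball z 1" for p0
  proof -
    from p0 have "p0 \<in> U" by simp
    from bspec[OF traj this] obtain p m q where sol: "closed_loop_solution E \<nu> \<eta> (?F z) p m"
      and init: "p 0 = p0" and cong: "congruent_config q z"
      and decay: "\<forall>t\<ge>0. norm (p t - q) \<le> N * exp (- c * t)"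
      by (elim exE conjE)
    have Fq: "?F q = ?F z" by (rule congruent_distance_map[OF E cong])
    have sol': "(p t, m t) \<in> state_space E"
      "(p has_vector_derivative \<nu> (p t, m t) (?F z - m t)) (at t within {0..})"
      "(m has_vector_derivative \<eta> (p t, m t) (?F z - m t)) (at t within {0..})" if "t \<ge> 0" for t
      using sol that unfolding closed_loop_solution_def by simp_all
    have m: "m t = ?F (p t)" if "t \<ge> 0" for t
      using sol'(1)[OF that] by (simp add: state_space_def)
    have in_space: "?F z - ?F (p t) \<in> edge_space E" for t
      using distance_map_in_edge_space[of E z] distance_map_in_edge_space[of E "p t"]
      by (simp add: edge_space_def)
    have lin: "linear_map_on (edge_space E) (\<nu> (p t, ?F (p t)))"
      "linear_map_on (edge_space E) (\<eta> (p t, ?F (p t)))" if "t \<ge> 0" for t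
      using compat sol'(1)[OF that] unfolding compatible_controller_def m[OF that] by simp_all
    have "norm (?F (p t) - ?F z) \<le> N' * exp (- c * t)" if t: "t \<ge> 0" for t
    proof -
      have d0: "norm (p0 - q) \<le> N" using spec[OF decay, of 0] init by simp
      have dt: "norm (p t - q) \<le> N * exp (- c * t)" using decay t by blast
      also have "\<dots> \<le> N * 1" using c t N by (intro mult_left_mono) auto
      finally have dN: "norm (p t - q) \<le> N" by simp
      have "norm p0 \<le> norm z + 1"
        using p0 norm_triangle_sub[of p0 z] by (simp add: dist_norm norm_minus_commute)
      then have q: "norm q \<le> N + (norm z + 1)"
        using d0 norm_triangle_sub[of q p0] by (simp add: norm_minus_commute)
      have "norm (p t + q) = norm ((p t - q) + (q + q))" by (simp add: add.commute)
      then have "norm (p t + q) \<le> norm (p t - q) + (norm q + norm q)"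
        using norm_triangle_ineq[of "p t - q" "q + q"] norm_triangle_ineq[of q q] by linarith
      also have "\<dots> \<le> N + ((N + (norm z + 1)) + (N + (norm z + 1)))"
        by (intro add_mono dN q)
      finally have "norm (p t + q) \<le> N + 2 * (N + (norm z + 1))" by simp
      then have "C * norm (p t + q) * norm (p t - q)
          \<le> C * (N + 2 * (N + (norm z + 1))) * (N * exp (- c * t))"
        using C(1) N dt by (intro mult_mono mult_nonneg_nonneg mult_left_mono) auto
      with C(2)[of "p t" q] show ?thesis by (simp add: N'_def Fq mult.assoc)
    qed
    moreover have "(p has_vector_derivative zero_extension E (\<nu> (p t, ?F (p t))) (?F z - ?F (p t)))
        (at t within {0..})" if t: "t \<ge> 0" for t
      using sol'(2)[OF t] unfolding m[OF t] zero_extension_eq[OF lin(1)[OF t] in_space] .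
    moreover have "((\<lambda>t. ?F (p t)) has_vector_derivative
        zero_extension E (\<eta> (p t, ?F (p t))) (?F z - ?F (p t))) (at t within {0..})" if t: "t \<ge> 0" for t
    proof (rule has_vector_derivative_transform)
      show "(m has_vector_derivative zero_extension E (\<eta> (p t, ?F (p t))) (?F z - ?F (p t)))
          (at t within {0..})"
        using sol'(3)[OF t] unfolding m[OF t] zero_extension_eq[OF lin(2)[OF t] in_space] .
    qed (use t m in auto)
    ultimately show ?thesis
      by (intro exI[of _ p] conjI allI impI init)
  qed
  then show ?thesis
    by (intro exI[of _ U] exI[of _ N'] exI[of _ c] conjI ballI U N' c)
qed

lemma stable_target_flow_decays:
  fixes z :: "real^'d::finite^'v::finite"
  assumes E: "simple_graph E" and compat: "compatible_controller E \<nu> \<eta>"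
    and stable: "locally_exponentially_stable E \<nu> \<eta> z" and z: "z \<in> regular_configs E"
    and J: "coord_complement J (edge_pairing E z)"
    and near: "\<forall>p::real^'d^'v. inj (augmented_gram J (edge_pairing E p)) \<longrightarrow>
      coord_complement J (edge_pairing E p)"
  defines "H \<equiv> zero_extension E (\<eta> (z, distance_map E z))"
  shows "((\<lambda>t. exp_flow (target_linearization J (edge_pairing E z) H) t x) \<longlongrightarrow> 0) at_top"
proof -
  let ?F = "distance_map E :: real^'d^'v \<Rightarrow> _"
  let ?V = "\<lambda>p. zero_extension E (\<nu> (p, ?F p))" and ?H = "\<lambda>p. zero_extension E (\<eta> (p, ?F p))"
  let ?A = "target_linearization J (edge_pairing E z) H"
  interpret coord_complement J "edge_pairing E z" by fact
  obtain U N c where U: "open U" "z \<in> U" "U \<subseteq> regular_configs E" and N: "N > 0" "c > 0"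
    and traj: "\<forall>p0\<in>U \<inter> ball z 1. \<exists>p. p 0 = p0 \<and> (\<forall>t\<ge>0.
      (p has_vector_derivative ?V (p t) (?F z - ?F (p t))) (at t within {0..}) \<and>
      ((\<lambda>t. ?F (p t)) has_vector_derivative ?H (p t) (?F z - ?F (p t))) (at t within {0..}) \<and>
      norm (?F (p t) - ?F z) \<le> N * exp (- c * t))"
    using stable_target_trajectory[OF E compat stable] by (elim exE conjE)
  have smooth: "\<forall>x\<in>edge_space E. smooth_on_subset (state_space E) (\<lambda>s. \<nu> s x)"
    "\<forall>x\<in>edge_space E. smooth_on_subset (state_space E) (\<lambda>s. \<eta> s x)"
    using compat unfolding compatible_controller_def by simp_all
  obtain L1 where L1: "L1 \<ge> 0" "\<forall>\<^sub>F p in nhds z. p \<in> regular_configs E \<longrightarrow>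
      (\<forall>x. norm (?V p x - ?V z x) \<le> L1 * norm (p - z) * norm x)"
    using controller_lipschitz_at[of E \<nu>, OF E smooth(1) z] by (elim exE conjE)
  obtain L2 where L2: "L2 \<ge> 0" "\<forall>\<^sub>F p in nhds z. p \<in> regular_configs E \<longrightarrow>
      (\<forall>x. norm (?H p x - ?H z x) \<le> L2 * norm (p - z) * norm x)"
    using controller_lipschitz_at[of E \<eta>, OF E smooth(2) z] by (elim exE conjE)
  obtain L3 where L3: "L3 \<ge> 0" "\<forall>\<^sub>F p in nhds z. \<forall>v.
      norm (edge_pairing E p v - P (edge_pairing E p v)) \<le> L3 * norm (p - z) * norm (edge_pairing E p v)"
    using range_projection_defect[OF bounded_bilinear_edge_pairing J near] by (elim exE conjE)
  have "\<forall>\<^sub>F p in nhds z. p \<in> U" using U by (intro eventually_nhds_in_open)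
  with L1(2) L2(2) L3(2) have "\<forall>\<^sub>F p in nhds z. p \<in> U \<and>
      (\<forall>x. norm (?V p x - ?V z x) \<le> L1 * norm (p - z) * norm x) \<and>
      (\<forall>x. norm (?H p x - ?H z x) \<le> L2 * norm (p - z) * norm x) \<and>
      (\<forall>v. norm (edge_pairing E p v - P (edge_pairing E p v))
        \<le> L3 * norm (p - z) * norm (edge_pairing E p v))"
  proof eventually_elim
    case (elim p)
    then have "p \<in> regular_configs E" using U(3) by blast
    with elim show ?case by (intro conjI) (simp_all only: simp_thms)
  qed
  then obtain r where r: "r > 0" and near_r: "\<forall>p. dist p z < r \<longrightarrow> p \<in> U \<and>
      (\<forall>x. norm (?V p x - ?V z x) \<le> L1 * norm (p - z) * norm x) \<and>
      (\<forall>x. norm (?H p x - ?H z x) \<le> L2 * norm (p - z) * norm x) \<and>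
      (\<forall>v. norm (edge_pairing E p v - P (edge_pairing E p v))
        \<le> L3 * norm (p - z) * norm (edge_pairing E p v))"
    unfolding eventually_nhds_metric by (elim exE conjE)
  have rU: "\<And>p. dist p z < r \<Longrightarrow> p \<in> U"
    and rV: "\<And>p x. dist p z < r \<Longrightarrow> norm (?V p x - ?V z x) \<le> L1 * norm (p - z) * norm x"
    and rH: "\<And>p x. dist p z < r \<Longrightarrow> norm (?H p x - ?H z x) \<le> L2 * norm (p - z) * norm x"
    and rP: "\<And>p v. dist p z < r \<Longrightarrow> norm (edge_pairing E p v - P (edge_pairing E p v))
        \<le> L3 * norm (p - z) * norm (edge_pairing E p v)"
    using near_r by simp_all
  have linH: "linear H" unfolding H_def by (rule linear_zero_extension)
  obtain BV where BV: "BV > 0" "\<And>x. norm (?V z x) \<le> BV * norm x"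
    using linear_bounded_pos[OF linear_zero_extension[of E "\<nu> (z, ?F z)"]] by blast
  obtain BH where BH: "BH > 0" "\<And>x. norm (H x) \<le> BH * norm x"
    using linear_bounded_pos[OF linH] by blast
  obtain BF where BF: "BF > 0" "\<And>p q::real^'d^'v. norm (edge_pairing E p q) \<le> norm p * norm q * BF"
    using bounded_bilinear.pos_bounded[OF bounded_bilinear_edge_pairing[of E]] by blast
  define L where "L = BV + L1 + BH + L2 + (BH + 1) * L3 + BF"
  have Lge: "BV + L1 \<le> L" "BH + L2 \<le> L" "L2 + (BH + 1) * L3 \<le> L" "BF \<le> L" "L > 0"
    using BV(1) L1(1) BH(1) L2(1) L3(1) BF(1) by (auto simp: L_def add_nonneg_pos add_pos_nonneg)
  define \<rho> where "\<rho> = min r 1"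
  have \<rho>: "\<rho> > 0" using r by (simp add: \<rho>_def)
  have ball: "dist p z < r" "norm (p - z) \<le> 1" "p \<in> U \<inter> ball z 1" if "p \<in> ball z \<rho>" for p
    using that rU[of p] by (auto simp: \<rho>_def dist_commute dist_norm[of p z])
  have err: "norm (?F z - ?F p) = norm (?F p - ?F z)" for p by (rule norm_minus_commute)
  have perturb: "norm (f p x) \<le> L * norm x"
    if "norm (f p x - f z x) \<le> K * norm (p - z) * norm x" "norm (f z x) \<le> B * norm x"
      "B + K \<le> L" "K \<ge> 0" "norm (p - z) \<le> 1"
    for f :: "real^'d^'v \<Rightarrow> real^('v set) \<Rightarrow> 'w::euclidean_space" and p x K B
  proof -
    have "norm (f p x) \<le> norm (f z x) + norm (f p x - f z x)"
      by (rule norm_triangle_sub)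
    also have "\<dots> \<le> B * norm x + K * 1 * norm x"
      using that by (intro add_mono order_trans[OF that(1)] mult_right_mono mult_left_mono) auto
    also have "\<dots> = (B + K) * norm x" by (simp add: algebra_simps)
    also have "\<dots> \<le> L * norm x" using that(3) by (rule mult_right_mono) simp
    finally show ?thesis .
  qed
  interpret exponentially_attracted ?F "\<lambda>p. ?V p (?F z - ?F p)" "\<lambda>p. ?H p (?F z - ?F p)"
    "\<lambda>v. edge_pairing E z (2 *\<^sub>R v)" ?A z \<rho> L N c
  proof (rule exponentially_attracted.intro)
    show "\<rho> > 0" "L > 0" "N > 0" "c > 0" using \<rho> Lge N by auto
    show "linear (\<lambda>v. edge_pairing E z (2 *\<^sub>R v))"
      by (rule linearI) (simp_all add: edge_pairing_bilinear scaleR_right_distrib)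
    show "linear ?A" by (rule linear_target_linearization[OF linH])
    fix p assume p: "p \<in> ball z \<rho>"
    have "?F p - ?F z - edge_pairing E z (2 *\<^sub>R (p - z)) = edge_pairing E (p - z) (p - z)"
      unfolding distance_map_eq_edge_pairing[OF E] scaleR_2 edge_pairing_bilinear
        edge_pairing_commute[of E p z] by (simp add: algebra_simps)
    then have "norm (?F p - ?F z - edge_pairing E z (2 *\<^sub>R (p - z))) \<le> BF * (norm (p - z))\<^sup>2"
      using BF(2)[of "p - z" "p - z"] by (simp add: power2_eq_square mult_ac)
    also have "\<dots> \<le> L * (norm (p - z))\<^sup>2" using Lge(4) by (rule mult_right_mono) simp
    finally show "norm (?F p - ?F z - edge_pairing E z (2 *\<^sub>R (p - z))) \<le> L * (norm (p - z))\<^sup>2" .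
    show "norm (?V p (?F z - ?F p)) \<le> L * norm (?F p - ?F z)"
      unfolding err[symmetric]
      by (rule perturb[of ?V p "?F z - ?F p", OF rV BV(2) Lge(1) L1(1)]) (use ball[OF p] in auto)
    show "norm (?H p (?F z - ?F p)) \<le> L * norm (?F p - ?F z)"
      unfolding err[symmetric]
      by (rule perturb[of ?H p "?F z - ?F p", OF rH BH(2)[unfolded H_def] Lge(2) L2(1)]) (use ball[OF p] in auto)
    show "norm (?H p (?F z - ?F p) - ?A (?F p - ?F z)) \<le> L * norm (p - z) * norm (?F p - ?F z)"
    proof -
      define x where "x = ?F p - ?F z"
      \<comment> \<open>The error is tangent at the midpoint, hence nearly tangent at \<open>z\<close>.\<close>
      define mid where "mid = (1 / 2) *\<^sub>R (p + z)"
      have "mid - z = (1 / 2) *\<^sub>R (p - z)"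
        by (simp add: mid_def algebra_simps flip: scaleR_add_left)
      then have mid: "norm (mid - z) = norm (p - z) / 2" by simp
      have x: "x = edge_pairing E mid (2 *\<^sub>R (p - z))"
        unfolding x_def mid_def distance_map_diff[OF E] edge_pairing_bilinear(5,6) by simp
      have "dist mid z < r" using ball(1)[OF p] mid norm_ge_zero[of "p - z"] unfolding dist_norm by linarith
      from rP[OF this, of "2 *\<^sub>R (p - z)"]
      have "norm (x - P x) \<le> L3 * norm (mid - z) * norm x" by (simp only: x)
      also have "\<dots> \<le> L3 * norm (p - z) * norm x"
        using L3(1) mid norm_ge_zero[of "p - z"]
        by (intro mult_right_mono mult_left_mono) (linarith | simp)+
      finally have defect: "norm (x - P x) \<le> L3 * norm (p - z) * norm x" .
      have "?H p (- x) - ?A x = - (?H p x - H x) - H (x - P x) + (x - P x)"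
        by (simp add: target_linearization_def linear_diff[OF linH]
            linear_neg[OF linear_zero_extension])
      then have "norm (?H p (- x) - ?A x) \<le> norm (?H p x - H x) + norm (H (x - P x)) + norm (x - P x)"
        using norm_triangle_ineq[of "- (?H p x - H x) - H (x - P x)" "x - P x"]
          norm_triangle_ineq4[of "- (?H p x - H x)" "H (x - P x)"]
        by (simp only: norm_minus_cancel)
      also have "\<dots> \<le> L2 * norm (p - z) * norm x + BH * norm (x - P x) + norm (x - P x)"
        by (intro add_mono BH rH[OF ball(1)[OF p], folded H_def] order_refl)
      also have "\<dots> = L2 * norm (p - z) * norm x + (BH + 1) * norm (x - P x)"
        by (simp add: algebra_simps)
      also have "\<dots> \<le> L2 * norm (p - z) * norm x + (BH + 1) * (L3 * norm (p - z) * norm x)"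
        using defect BH(1) by (intro add_left_mono mult_left_mono) auto
      also have "\<dots> = (L2 + (BH + 1) * L3) * (norm (p - z) * norm x)" by (simp add: algebra_simps)
      also have "\<dots> \<le> L * (norm (p - z) * norm x)"
        using Lge(3) by (rule mult_right_mono) simp
      finally show ?thesis by (simp add: x_def mult.assoc)
    qed
    from bspec[OF traj ball(3)[OF p]]
    show "\<exists>q. q 0 = p \<and> (\<forall>t\<ge>0.
      (q has_vector_derivative ?V (q t) (?F z - ?F (q t))) (at t within {0..}) \<and>
      ((\<lambda>t. ?F (q t)) has_vector_derivative ?H (q t) (?F z - ?F (q t))) (at t within {0..}) \<and>
      norm (?F (q t) - ?F z) \<le> N * exp (- c * t))" .
  qed
  show ?thesis
  proof (rule linear_flow_decays)
    fix x
    obtain v y where "x = edge_pairing E z v + y" "?A y = - y"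
      using target_linearization_decompose[OF linH, of x] by blast
    then show "\<exists>v y. x = edge_pairing E z (2 *\<^sub>R v) + y \<and> ?A y = - y"
      by (intro exI[of _ "(1 / 2) *\<^sub>R v"] exI[of _ y]) simp
  qed
qed


section \<open>Hyperbolicity as a polynomial condition\<close>

lemma rational_controller_common_denominator:
  fixes \<eta> :: "(real^'d::finite^'v::finite) \<times> (real^('v set)) \<Rightarrow> real^('v set) \<Rightarrow> real^('v set)"
  assumes E: "simple_graph E" and compat: "compatible_controller E \<nu> \<eta>"
    and rational: "rational_controller E \<nu> \<eta>"
  obtains D :: "real^'d^'v \<Rightarrow> real" and M :: "real^'d^'v \<Rightarrow> real^('v set)^('v set)"
  where "rat_polynomial_function D" "\<exists>p. D p \<noteq> 0"
    "\<And>i j. rat_polynomial_function (\<lambda>p. M p $ i $ j)"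
    "\<forall>p\<in>regular_configs E. D p \<noteq> 0 \<longrightarrow>
      (\<forall>x. M p *v x = D p *\<^sub>R zero_extension E (\<eta> (p, distance_map E p)) x)"
proof -
  let ?S = "state_space E :: ((real^'d^'v) \<times> (real^('v set))) set"
  have "\<forall>w\<in>E \<times> E. \<exists>PQ. rat_polynomial_function (fst PQ) \<and> rat_polynomial_function (snd PQ) \<and>
      (\<exists>s\<in>?S. snd PQ s \<noteq> 0) \<and>
      (\<forall>s\<in>?S. snd PQ s \<noteq> 0 \<longrightarrow> \<eta> s (axis (fst w) 1) $ snd w = fst PQ s / snd PQ s)"
  proof
    fix w assume "w \<in> E \<times> E"
    then have "rational_function_on ?S (\<lambda>s. \<eta> s (axis (fst w) 1) $ snd w)"
      using rational unfolding rational_controller_def by auto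
    then obtain P Q where "rat_polynomial_function P" "rat_polynomial_function Q"
      "\<exists>s\<in>?S. Q s \<noteq> 0" "\<forall>s\<in>?S. Q s \<noteq> 0 \<longrightarrow> \<eta> s (axis (fst w) 1) $ snd w = P s / Q s"
      unfolding rational_function_on_def by (elim exE conjE)
    then show "\<exists>PQ. rat_polynomial_function (fst PQ) \<and> rat_polynomial_function (snd PQ) \<and>
      (\<exists>s\<in>?S. snd PQ s \<noteq> 0) \<and>
      (\<forall>s\<in>?S. snd PQ s \<noteq> 0 \<longrightarrow> \<eta> s (axis (fst w) 1) $ snd w = fst PQ s / snd PQ s)"
      by (intro exI[of _ "(P, Q)"]) simp
  qed
  from bchoice[OF this] obtain PQ where PQ: "\<forall>w\<in>E \<times> E. rat_polynomial_function (fst (PQ w)) \<and>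
      rat_polynomial_function (snd (PQ w)) \<and> (\<exists>s\<in>?S. snd (PQ w) s \<noteq> 0) \<and>
      (\<forall>s\<in>?S. snd (PQ w) s \<noteq> 0 \<longrightarrow> \<eta> s (axis (fst w) 1) $ snd w = fst (PQ w) s / snd (PQ w) s)"
    by (elim exE)
  define n where "n w p = fst (PQ w) (p, distance_map E p)" for w p
  define d where "d w p = snd (PQ w) (p, distance_map E p)" for w p
  have n: "rat_polynomial_function (n w)" and d: "rat_polynomial_function (d w)" if "w \<in> E \<times> E" for w
    unfolding n_def[abs_def] d_def[abs_def]
    using PQ that by (auto intro!: rat_polynomial_function_on_graph[OF E])
  have d0: "\<exists>p. d w p \<noteq> 0" if w: "w \<in> E \<times> E" for w
  proof -
    obtain s where "s \<in> ?S" "snd (PQ w) s \<noteq> 0" using PQ w by blast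
    then have "d w (fst s) \<noteq> 0" by (auto simp: d_def state_space_def)
    then show ?thesis ..
  qed
  have entry: "\<eta> (p, distance_map E p) (axis e 1) $ e' = n (e, e') p / d (e, e') p"
    if "e \<in> E" "e' \<in> E" "p \<in> regular_configs E" "d (e, e') p \<noteq> 0" for e e' p
    using bspec[OF PQ, of "(e, e')"] that state_space_iff[of p E] by (simp add: n_def d_def)
  define D where "D p = (\<Prod>w\<in>E \<times> E. d w p)" for p
  define M :: "real^'d^'v \<Rightarrow> real^('v set)^('v set)" where
    "M p = (\<chi> e' e. if e \<in> E \<and> e' \<in> E then n (e, e') p * (\<Prod>w\<in>E \<times> E - {(e, e')}. d w p) else 0)" for p
  show thesis
  proof (rule that[of D M])
    show "rat_polynomial_function D"
      unfolding D_def[abs_def] by (intro rat_polynomial_function_prod d)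
    show "\<exists>p. D p \<noteq> 0"
      unfolding D_def by (intro rat_polynomial_function_prod_nonzero d d0) simp
    show "rat_polynomial_function (\<lambda>p. M p $ i $ j)" for i j
    proof (cases "j \<in> E \<and> i \<in> E")
      case True
      then have "rat_polynomial_function (\<lambda>p. n (j, i) p * (\<Prod>w\<in>E \<times> E - {(j, i)}. d w p))"
        by (intro rat_polynomial_function.mult rat_polynomial_function_prod n d) auto
      then show ?thesis using True by (simp add: M_def)
    next
      case False
      then have "(\<lambda>p. M p $ i $ j) = (\<lambda>p. 0)" by (auto simp: M_def)
      then show ?thesis by (simp add: rat_polynomial_function.const)
    qed
    show "\<forall>p\<in>regular_configs E. D p \<noteq> 0 \<longrightarrow>
      (\<forall>x. M p *v x = D p *\<^sub>R zero_extension E (\<eta> (p, distance_map E p)) x)"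
    proof (intro ballI impI allI)
      fix p x assume p: "p \<in> regular_configs E" and D0: "D p \<noteq> 0"
      let ?\<eta> = "\<eta> (p, distance_map E p)"
      have d_nz: "d w p \<noteq> 0" if "w \<in> E \<times> E" for w
        using D0 that unfolding D_def by (auto simp: prod_zero_iff)
      have M: "M p $ e' $ e = D p * ?\<eta> (axis e 1) $ e'" if "e \<in> E" "e' \<in> E" for e e'
      proof -
        have "D p = d (e, e') p * (\<Prod>w\<in>E \<times> E - {(e, e')}. d w p)"
          unfolding D_def by (rule prod.remove) (use that in auto)
        then show ?thesis using that p entry[OF that p] d_nz[of "(e, e')"] by (simp add: M_def)
      qed
      have off: "?\<eta> (axis e 1) $ e' = 0" if "e \<in> E" "e' \<notin> E" for e e'
      proof -
        have "axis e 1 \<in> edge_space E" using that by (auto simp: edge_space_def axis_def)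
        moreover have "?\<eta> ` edge_space E \<subseteq> edge_space E"
          using compat p state_space_iff[of p E] unfolding compatible_controller_def by blast
        ultimately have "?\<eta> (axis e 1) \<in> edge_space E" by blast
        then show ?thesis using that by (simp add: edge_space_def)
      qed
      have "(M p *v x) $ e' = D p * zero_extension E ?\<eta> x $ e'" for e'
      proof -
        have "(M p *v x) $ e' = (\<Sum>e\<in>UNIV. M p $ e' $ e * x $ e)"
          by (simp add: matrix_vector_mult_def)
        also have "\<dots> = (\<Sum>e\<in>E. M p $ e' $ e * x $ e)"
          by (rule sum.mono_neutral_right) (auto simp: M_def)
        also have "\<dots> = (\<Sum>e\<in>E. D p * (x $ e * ?\<eta> (axis e 1) $ e'))"
        proof (rule sum.cong[OF refl])
          fix e assume e: "e \<in> E"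
          show "M p $ e' $ e * x $ e = D p * (x $ e * ?\<eta> (axis e 1) $ e')"
          proof (cases "e' \<in> E")
            case True
            then show ?thesis by (simp add: M[OF e])
          next
            case False
            then show ?thesis by (simp add: off[OF e] M_def)
          qed
        qed
        finally show ?thesis by (simp add: zero_extension_def sum_distrib_left)
      qed
      then show "M p *v x = D p *\<^sub>R zero_extension E ?\<eta> x" by (simp add: vec_eq_iff)
    qed
  qed
qed

theorem mainTheorem3:
  fixes E :: "'v::finite set set"
    and \<nu> :: "(real^'d::finite^'v) \<times> (real^('v set)) \<Rightarrow> real^('v set) \<Rightarrow> real^'d^'v"
    and \<eta> :: "(real^'d^'v) \<times> (real^('v set)) \<Rightarrow> real^('v set) \<Rightarrow> real^('v set)"
  assumes "simple_graph E"
    and "rigid_graph TYPE('d) E"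
    and "compatible_controller E \<nu> \<eta>"
    and "rational_controller E \<nu> \<eta>"
  shows "\<exists>X. proper_algebraic_over_rat X \<and>
           (\<forall>pstar\<in>regular_configs E - X.
              locally_exponentially_stable E \<nu> \<eta> pstar \<longrightarrow> strongly_admissible E \<eta>)"
proof -
  note E = assms(1) and compat = assms(3)
  let ?\<beta> = "edge_pairing E :: real^'d^'v \<Rightarrow> _" and ?F = "distance_map E :: real^'d^'v \<Rightarrow> _"
  let ?H = "\<lambda>p. zero_extension E (\<eta> (p, ?F p))"
  obtain D M where D: "rat_polynomial_function D" "\<exists>p. D p \<noteq> 0"
    and M: "\<And>i j. rat_polynomial_function (\<lambda>p::real^'d^'v. M p $ i $ j)"
    and MD: "\<forall>p\<in>regular_configs E. D p \<noteq> 0 \<longrightarrow> (\<forall>x. M p *v x = D p *\<^sub>R ?H p x)"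
    using rational_controller_common_denominator[OF E compat assms(4)] by blast
  obtain J p0 where J: "inj (augmented_gram J (?\<beta> p0))"
    and near: "\<forall>p. inj (augmented_gram J (?\<beta> p)) \<longrightarrow> coord_complement J (?\<beta> p)"
    using obtain_generic_complement[of ?\<beta>, OF linear_edge_pairing] by blast
  \<comment> \<open>At a regular \<open>p\<close> with \<open>D p \<noteq> 0\<close>, \<open>m p\<close> is \<open>- D p\<close> times the linearization composed with \<open>k p\<close>;
    both have polynomial entries.\<close>
  define k where "k p = augmented_gram J (?\<beta> p)" for p
  define m where "m p y = M p *v gram (?\<beta> p) y + D p *\<^sub>R coord_proj J y" for p y
  define h1 where "h1 p = det (matrix (k p))" for p
  define h2 where "h2 p = det (lyapunov_matrix (matrix (m p)) (matrix (k p)))" for p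
  have lin_k: "linear (k p)" for p
    unfolding k_def by (rule linear_augmented_gram)
  have lin_m: "linear (m p)" for p
    unfolding m_def
    using linear_compose[OF linear_gram[of "?\<beta> p"] matrix_vector_mul_linear[of "M p"]]
    by (intro linear_compose_add linear_compose_scale_right linear_coord_proj) (simp add: o_def)
  have coord_rat: "rat_polynomial_function (\<lambda>p. coord_proj J (axis j 1) $ i)" for i j
    by (rule rat_polynomial_function.const) (auto simp: coord_proj_def axis_def)
  have k_rat: "rat_polynomial_function (\<lambda>p. matrix (k p) $ i $ j)" for i j
    unfolding k_def matrix_def augmented_gram_def
    by (simp add: rat_polynomial_function.add rat_polynomial_function_gram coord_rat)
  have m_rat: "rat_polynomial_function (\<lambda>p. matrix (m p) $ i $ j)" for i j
    unfolding m_def matrix_def matrix_vector_mult_def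
    by (simp add: rat_polynomial_function.add rat_polynomial_function_sum rat_polynomial_function.mult
        rat_polynomial_function_gram coord_rat M D)
  have h1: "rat_polynomial_function h1"
    unfolding h1_def[abs_def] by (intro rat_polynomial_function_det k_rat)
  have h2: "rat_polynomial_function h2"
    unfolding h2_def[abs_def] lyapunov_matrix_def
    by (intro rat_polynomial_function_det)
       (simp add: rat_polynomial_function.add rat_polynomial_function.mult k_rat m_rat)
  have h1_inj: "h1 p \<noteq> 0 \<longleftrightarrow> inj (augmented_gram J (?\<beta> p))" for p
    unfolding h1_def using det_nz_iff_inj[OF lin_k] by (simp add: k_def)
  have admissible: "strongly_admissible E \<eta>"
    if z: "z \<in> regular_configs E" "D z \<noteq> 0" "h1 z \<noteq> 0" and
      stable: "locally_exponentially_stable E \<nu> \<eta> z" for z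
  proof -
    have "h2 z \<noteq> 0"
    proof -
      have J: "coord_complement J (?\<beta> z)" using near h1_inj z(3) by blast
      interpret coord_complement J "?\<beta> z" by fact
      let ?A = "target_linearization J (?\<beta> z) (?H z)"
      show ?thesis
        unfolding h2_def
      proof (rule lyapunov_matrix_det_nonzero[OF lin_k])
        show "inj (k z)" using inj by (simp add: k_def)
        show "linear ?A" by (rule linear_target_linearization[OF linear_zero_extension])
        show "D z \<noteq> 0" by fact
        show "m z y = (- D z) *\<^sub>R ?A (k z y)" for y
          using MD z(1,2) unfolding m_def k_def target_linearization_K
          by (simp add: scaleR_right_distrib scaleR_right_diff_distrib)
        show "((\<lambda>t. exp_flow ?A t x) \<longlongrightarrow> 0) at_top" for x
          by (rule stable_target_flow_decays[OF E compat stable z(1) J near])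
      qed
    qed
    define X where "X = {p. D p * h1 p * h2 p = 0}"
    have "proper_algebraic_over_rat X"
      unfolding X_def
      by (rule proper_algebraic_over_rat_zeros[of _ z])
         (use D(1) h1 h2 z \<open>h2 z \<noteq> 0\<close> in \<open>auto intro!: rat_polynomial_function.mult\<close>)
    moreover have "hyperbolic_on (tangent_space (regular_values TYPE('d) E) (?F p)) (\<eta> (p, ?F p))"
      if p: "p \<in> regular_configs E - X" for p
      unfolding hyperbolic_on_def
    proof (intro allI impI notI)
      fix \<mu> :: complex
      assume "eigenvalue_on (tangent_space (regular_values TYPE('d) E) (?F p)) (\<eta> (p, ?F p)) \<mu>"
        and \<mu>: "Re \<mu> = 0"
      then obtain w where w: "w \<noteq> 0"
        and re: "Re_vec w \<in> tangent_space (regular_values TYPE('d) E) (?F p)"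
        and im: "Im_vec w \<in> tangent_space (regular_values TYPE('d) E) (?F p)"
        and eig: "complexify (\<eta> (p, ?F p)) w = \<mu> *s w"
        unfolding eigenvalue_on_def by (elim exE conjE)
      have reg: "p \<in> regular_configs E" and nz: "D p \<noteq> 0" "h1 p \<noteq> 0" "h2 p \<noteq> 0"
        using p by (auto simp: X_def)
      interpret coord_complement J "?\<beta> p" using near h1_inj nz(2) by blast
      note sub = tangent_space_regular_values_subset[OF E reg]
      obtain u v where u: "Re_vec w = ?\<beta> p u" and v: "Im_vec w = ?\<beta> p v"
        using subsetD[OF sub re] subsetD[OF sub im] by (elim rangeE)
      have lin: "linear_map_on (edge_space E) (\<eta> (p, ?F p))"
        using compat reg state_space_iff[of p E] unfolding compatible_controller_def by blast
      have m: "m p (Kinv (?\<beta> p y)) = D p *\<^sub>R \<eta> (p, ?F p) (?\<beta> p y)" for y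
        using MD reg nz(1) range_preimage[OF K_Kinv]
          zero_extension_eq[OF lin edge_pairing_in_edge_space] by (simp add: m_def)
      have comp: "Complex (\<eta> (p, ?F p) (Re_vec w) $ i) (\<eta> (p, ?F p) (Im_vec w) $ i) = \<mu> * w $ i" for i
        using arg_cong[OF eig, of "\<lambda>x. x $ i"] by (simp add: complexify_def)
      have "\<eta> (p, ?F p) (Re_vec w) = (- Im \<mu>) *\<^sub>R Im_vec w"
        using arg_cong[OF comp, of Re] \<mu> by (simp add: vec_eq_iff Im_vec_def)
      moreover have "\<eta> (p, ?F p) (Im_vec w) = Im \<mu> *\<^sub>R Re_vec w"
        using arg_cong[OF comp, of Im] \<mu> by (simp add: vec_eq_iff Re_vec_def)
      ultimately have "m p (Kinv (?\<beta> p u)) = (- (D p * Im \<mu>)) *\<^sub>R k p (Kinv (?\<beta> p v))"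
        "m p (Kinv (?\<beta> p v)) = (D p * Im \<mu>) *\<^sub>R k p (Kinv (?\<beta> p u))"
        by (simp_all add: m[of u, folded u] m[of v, folded v] k_def K_Kinv flip: u v)
      from lyapunov_matrix_no_imaginary_pair[OF nz(3)[unfolded h2_def] lin_m lin_k this]
      have "K (Kinv (?\<beta> p u)) = K 0" "K (Kinv (?\<beta> p v)) = K 0" by simp_all
      then have "Re_vec w = 0" "Im_vec w = 0"
        by (simp_all add: u v K_Kinv linear_0[OF linear_K])
      then have "w = 0" by (simp add: Re_vec_def Im_vec_def vec_eq_iff complex_eq_iff)
      with w show False by contradiction
    qed
    ultimately show ?thesis unfolding strongly_admissible_def by blast
  qed
  obtain a where "D a * h1 a \<noteq> 0"
    using D(2) J h1_inj[of p0] rat_polynomial_function_mult_nonzero[OF D(1) _ h1] by blast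
  then have "proper_algebraic_over_rat {p. D p * h1 p = 0}"
    by (intro proper_algebraic_over_rat_zeros rat_polynomial_function.mult D h1)
  then show ?thesis
    using admissible by (intro exI[of _ "{p. D p * h1 p = 0}"]) auto
qed

end
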